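(* Let $X$ be a complex Banach space, $p\in(1,\infty)$, $r>0$, $A$ a generator of a strongly continuous semigroup on $X$, $a\in W^{1,p}(\mathbb{R}_+,\mathbb{C})$, and $\mu:[-r,0]\to\mathcal{L}(X)$ of bounded variation, continuous at $0$, with $|\mu|([-\varepsilon,0])\to0$ as $\varepsilon\to0$; $L\varphi=\int_{-r}^0d\mu(\theta)\varphi(\theta)$ for $\varphi\in W^{1,p}([-r,0],X)$. On $\mathcal{X}_0=X\times L^p(\mathbb{R}_+,X)$ let $\mathcal{A}^{\delta_0}(x,f)=(Ax+f(0),\,a(\cdot)Ax+f')$ and $\mathcal{A}_0(x,f)=(Ax+f(0),\,f')$, both with domain $D(A)\times W^{1,p}(\mathbb{R}_+,X)$. On $\mathcal{X}=\mathcal{X}_0\times L^p([-r,0],X)$ let $\mathfrak{A}_L(x,f,\varphi)=(Ax+f(0)+L\varphi,\,a(\cdot)Ax+f',\,\varphi')$ with $D(\mathfrak{A}_L)=\{(x,f,\varphi)\in D(A)\times W^{1,p}(\mathbb{R}_+,X)\times W^{1,p}([-r,0],X):\varphi(0)=x\}$. Then for $\lambda\in\mathbb{C}_0\cap\rho(\mathcal{A}^{\delta_0})\cap\rho(\mathcal{A}_0)$, $$\lambda\in\rho(\mathfrak{A}_L)\iff\lambda\in\rho\big((1+\hat a(\lambda))A+Le_\lambda\big).$$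
   Context: $\mathbb{C}_0=\{\lambda\in\mathbb{C}:\operatorname{Re}\lambda>0\}$. $\hat a(\lambda)=\int_0^\infty e^{-\lambda t}a(t)\,dt$ is the Laplace transform of $a$. $e_\lambda x$ is the function $\theta\mapsto e^{\lambda\theta}x$ on $[-r,0]$, so $Le_\lambda x=\int_{-r}^0e^{\lambda\theta}d\mu(\theta)x$; the operator $(1+\hat a(\lambda))A+Le_\lambda$ has domain $D(A)$. *)

theory Defs
  imports "HOL-Analysis.Analysis"
begin

text \<open>A complex Banach space is modelled as a real Banach space (type class banach)
together with a complex scalar multiplication sm extending the real one and
satisfying absolute homogeneity of the norm.\<close>

definition complex_banach_smul :: "(complex \<Rightarrow> 'a::banach \<Rightarrow> 'a) \<Rightarrow> bool" where
  "complex_banach_smul sm \<longleftrightarrow>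
     (\<forall>c x y. sm c (x + y) = sm c x + sm c y) \<and>
     (\<forall>c d x. sm (c + d) x = sm c x + sm d x) \<and>
     (\<forall>c d x. sm (c * d) x = sm c (sm d x)) \<and>
     (\<forall>s x. sm (complex_of_real s) x = s *\<^sub>R x) \<and>
     (\<forall>c x. norm (sm c x) = cmod c * norm x)"

definition complex_linear :: "(complex \<Rightarrow> 'a::banach \<Rightarrow> 'a) \<Rightarrow> ('a \<Rightarrow> 'a) \<Rightarrow> bool" where
  "complex_linear sm T \<longleftrightarrow> linear T \<and> (\<forall>c x. T (sm c x) = sm c (T x))"

definition C0_semigroup :: "(complex \<Rightarrow> 'a::banach \<Rightarrow> 'a) \<Rightarrow> (real \<Rightarrow> 'a \<Rightarrow> 'a) \<Rightarrow> bool" where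
  "C0_semigroup sm T \<longleftrightarrow>
     (\<forall>t\<ge>0. bounded_linear (T t) \<and> complex_linear sm (T t)) \<and>
     T 0 = id \<and>
     (\<forall>s\<ge>0. \<forall>t\<ge>0. T (s + t) = T s \<circ> T t) \<and>
     (\<forall>x. ((\<lambda>t. T t x) \<longlongrightarrow> x) (at_right 0))"

definition is_C0_generator :: "(complex \<Rightarrow> 'a::banach \<Rightarrow> 'a) \<Rightarrow> 'a set \<Rightarrow> ('a \<Rightarrow> 'a) \<Rightarrow> bool" where
  "is_C0_generator sm D A \<longleftrightarrow>
     (\<exists>T. C0_semigroup sm T \<and>
          D = {x. \<exists>y. ((\<lambda>h. (T h x - x) /\<^sub>R h) \<longlongrightarrow> y) (at_right 0)} \<and>
          (\<forall>x\<in>D. ((\<lambda>h. (T h x - x) /\<^sub>R h) \<longlongrightarrow> A x) (at_right 0)))"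

definition simple_fun_leb :: "(real \<Rightarrow> 'b::real_normed_vector) \<Rightarrow> bool" where
  "simple_fun_leb s \<longleftrightarrow> finite (range s) \<and> (\<forall>c. s -` {c} \<in> sets lebesgue)"

definition strongly_measurable_on :: "real set \<Rightarrow> (real \<Rightarrow> 'b::real_normed_vector) \<Rightarrow> bool" where
  "strongly_measurable_on S f \<longleftrightarrow>
     (\<exists>s. (\<forall>n. simple_fun_leb (s n)) \<and>
          (AE t in lebesgue. t \<in> S \<longrightarrow> (\<lambda>n. s n t) \<longlonglongrightarrow> f t))"

definition Lp :: "real \<Rightarrow> real set \<Rightarrow> (real \<Rightarrow> 'b::real_normed_vector) \<Rightarrow> bool" where
  "Lp p S f \<longleftrightarrow> strongly_measurable_on S f \<and>
     (\<integral>\<^sup>+ t\<in>S. ennreal (norm (f t) powr p) \<partial>lebesgue) < \<infinity>"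

definition Lp_norm :: "real \<Rightarrow> real set \<Rightarrow> (real \<Rightarrow> 'b::real_normed_vector) \<Rightarrow> real" where
  "Lp_norm p S f = enn2real (\<integral>\<^sup>+ t\<in>S. ennreal (norm (f t) powr p) \<partial>lebesgue) powr (1 / p)"

text \<open>f is (the continuous representative of) an element of W^{1,p}(S) with derivative g,
  where S is an interval with left endpoint a.\<close>
definition W1p :: "real \<Rightarrow> real \<Rightarrow> real set \<Rightarrow> (real \<Rightarrow> 'b::real_normed_vector) \<Rightarrow> (real \<Rightarrow> 'b) \<Rightarrow> bool" where
  "W1p p a S f g \<longleftrightarrow> Lp p S f \<and> Lp p S g \<and> (\<forall>t\<in>S. (g has_integral (f t - f a)) {a..t})"

definition partition_var :: "(real \<Rightarrow> 'c::real_normed_vector) \<Rightarrow> real list \<Rightarrow> real" where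
  "partition_var f xs = (\<Sum>i<length xs - 1. norm (f (xs ! Suc i) - f (xs ! i)))"

definition bounded_variation_on :: "(real \<Rightarrow> 'c::real_normed_vector) \<Rightarrow> real \<Rightarrow> real \<Rightarrow> bool" where
  "bounded_variation_on f a b \<longleftrightarrow>
     bdd_above {partition_var f xs | xs. sorted xs \<and> set xs \<subseteq> {a..b}}"

definition total_variation :: "(real \<Rightarrow> 'c::real_normed_vector) \<Rightarrow> real \<Rightarrow> real \<Rightarrow> real" where
  "total_variation f a b = Sup {partition_var f xs | xs. sorted xs \<and> set xs \<subseteq> {a..b}}"

definition has_RS_integral ::
  "(real \<Rightarrow> 'a::real_normed_vector \<Rightarrow>\<^sub>L 'a) \<Rightarrow> (real \<Rightarrow> 'a) \<Rightarrow> real \<Rightarrow> real \<Rightarrow> 'a \<Rightarrow> bool" where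
  "has_RS_integral \<mu> \<phi> a b I \<longleftrightarrow>
     (\<forall>\<epsilon>>0. \<exists>\<delta>>0. \<forall>xs ts.
        xs \<noteq> [] \<and> hd xs = a \<and> last xs = b \<and> sorted xs \<and>
        (\<forall>i<length xs - 1. xs ! Suc i - xs ! i < \<delta>) \<and>
        length ts = length xs - 1 \<and>
        (\<forall>i<length ts. xs ! i \<le> ts ! i \<and> ts ! i \<le> xs ! Suc i) \<longrightarrow>
        norm ((\<Sum>i<length ts. blinfun_apply (\<mu> (xs ! Suc i) - \<mu> (xs ! i)) (\<phi> (ts ! i))) - I) < \<epsilon>)"

definition delay_op :: "(real \<Rightarrow> 'a::real_normed_vector \<Rightarrow>\<^sub>L 'a) \<Rightarrow> real \<Rightarrow> (real \<Rightarrow> 'a) \<Rightarrow> 'a" where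
  "delay_op \<mu> r \<phi> = (THE I. has_RS_integral \<mu> \<phi> (- r) 0 I)"

definition exp_fun :: "(complex \<Rightarrow> 'a \<Rightarrow> 'a) \<Rightarrow> complex \<Rightarrow> 'a \<Rightarrow> real \<Rightarrow> 'a" where
  "exp_fun sm lam x = (\<lambda>\<theta>. sm (exp (lam * complex_of_real \<theta>)) x)"

definition laplace :: "(real \<Rightarrow> complex) \<Rightarrow> complex \<Rightarrow> complex" where
  "laplace a lam = (LINT t:{0..}|lborel. exp (- lam * complex_of_real t) * a t)"

definition in_resolvent_X :: "(complex \<Rightarrow> 'a::banach \<Rightarrow> 'a) \<Rightarrow> 'a set \<Rightarrow> ('a \<Rightarrow> 'a) \<Rightarrow> complex \<Rightarrow> bool" where
  "in_resolvent_X sm D B lam \<longleftrightarrow>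
     (\<forall>y. \<exists>x\<in>D. sm lam x - B x = y) \<and>
     (\<exists>C. \<forall>x\<in>D. norm x \<le> C * norm (sm lam x - B x))"

text \<open>Same on X0 = X x L^p(R_+,X); the operator is given by its graph G (pairs (u, Bu)),
  elements of L^p are identified when their difference has zero norm.\<close>
definition in_resolvent_X0 :: "(complex \<Rightarrow> 'a::banach \<Rightarrow> 'a) \<Rightarrow> real \<Rightarrow>
    ((('a \<times> (real \<Rightarrow> 'a)) \<times> ('a \<times> (real \<Rightarrow> 'a))) set) \<Rightarrow> complex \<Rightarrow> bool" where
  "in_resolvent_X0 sm p G lam \<longleftrightarrow>
     (\<forall>y f. Lp p {0..} f \<longrightarrow>
        (\<exists>((x, h), (v, k))\<in>G. sm lam x - v = y \<and>
            Lp_norm p {0..} (\<lambda>t. sm lam (h t) - k t - f t) = 0)) \<and>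
     (\<exists>C. \<forall>((x, h), (v, k))\<in>G.
        norm x + Lp_norm p {0..} h \<le>
          C * (norm (sm lam x - v) + Lp_norm p {0..} (\<lambda>t. sm lam (h t) - k t)))"

definition in_resolvent_XX :: "(complex \<Rightarrow> 'a::banach \<Rightarrow> 'a) \<Rightarrow> real \<Rightarrow> real \<Rightarrow>
    ((('a \<times> (real \<Rightarrow> 'a) \<times> (real \<Rightarrow> 'a)) \<times> ('a \<times> (real \<Rightarrow> 'a) \<times> (real \<Rightarrow> 'a))) set) \<Rightarrow>
    complex \<Rightarrow> bool" where
  "in_resolvent_XX sm p r G lam \<longleftrightarrow>
     (\<forall>y f \<psi>. Lp p {0..} f \<longrightarrow> Lp p {-r..0} \<psi> \<longrightarrow>
        (\<exists>((x, h, \<phi>), (v, k, w))\<in>G. sm lam x - v = y \<and>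
            Lp_norm p {0..} (\<lambda>t. sm lam (h t) - k t - f t) = 0 \<and>
            Lp_norm p {-r..0} (\<lambda>t. sm lam (\<phi> t) - w t - \<psi> t) = 0)) \<and>
     (\<exists>C. \<forall>((x, h, \<phi>), (v, k, w))\<in>G.
        norm x + Lp_norm p {0..} h + Lp_norm p {-r..0} \<phi> \<le>
          C * (norm (sm lam x - v) + Lp_norm p {0..} (\<lambda>t. sm lam (h t) - k t)
               + Lp_norm p {-r..0} (\<lambda>t. sm lam (\<phi> t) - w t)))"

definition A_delta0 :: "(complex \<Rightarrow> 'a::banach \<Rightarrow> 'a) \<Rightarrow> real \<Rightarrow> 'a set \<Rightarrow> ('a \<Rightarrow> 'a) \<Rightarrow> (real \<Rightarrow> complex)
    \<Rightarrow> (('a \<times> (real \<Rightarrow> 'a)) \<times> ('a \<times> (real \<Rightarrow> 'a))) set" where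
  "A_delta0 sm p D A a =
     {((x, f), (A x + f 0, \<lambda>t. sm (a t) (A x) + g t)) | x f g. x \<in> D \<and> W1p p 0 {0..} f g}"

definition A_zero :: "real \<Rightarrow> 'a set \<Rightarrow> ('a::banach \<Rightarrow> 'a)
    \<Rightarrow> (('a \<times> (real \<Rightarrow> 'a)) \<times> ('a \<times> (real \<Rightarrow> 'a))) set" where
  "A_zero p D A =
     {((x, f), (A x + f 0, g)) | x f g. x \<in> D \<and> W1p p 0 {0..} f g}"

definition frakA_L :: "(complex \<Rightarrow> 'a::banach \<Rightarrow> 'a) \<Rightarrow> real \<Rightarrow> real \<Rightarrow> 'a set \<Rightarrow> ('a \<Rightarrow> 'a)
    \<Rightarrow> (real \<Rightarrow> complex) \<Rightarrow> (real \<Rightarrow> 'a \<Rightarrow>\<^sub>L 'a)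
    \<Rightarrow> (('a \<times> (real \<Rightarrow> 'a) \<times> (real \<Rightarrow> 'a)) \<times> ('a \<times> (real \<Rightarrow> 'a) \<times> (real \<Rightarrow> 'a))) set" where
  "frakA_L sm p r D A a \<mu> =
     {((x, f, \<phi>), (A x + f 0 + delay_op \<mu> r \<phi>, \<lambda>t. sm (a t) (A x) + g t, \<psi>)) | x f g \<phi> \<psi>.
        x \<in> D \<and> W1p p 0 {0..} f g \<and> W1p p (- r) {-r..0} \<phi> \<psi> \<and> \<phi> 0 = x}"

end

theory Submission
  imports Defs
begin

text \<open>
  Solving the last two components of \<open>(lam - \<AA>\<^sub>L)(x, h, \<phi>) = (y, f, \<psi>)\<close> determines \<open>h\<close> and \<open>\<phi>\<close> from \<open>x\<close>:
  \<open>\<phi>\<close> is \<open>\<theta> \<mapsto> exp(lam \<theta>) x\<close> plus a term bounded by the norm of \<open>\<psi>\<close>, and integrability of \<open>h\<close> at infinity forces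
  \<open>h(0)\<close> to be the Laplace transform of \<open>a(\<cdot>)Ax + f\<close> at \<open>lam\<close>. Inserting both into the first component
  leaves \<open>(lam - (1 + laplace a lam)A - L exp(lam \<cdot>)) x\<close> on the left and data bounded by the right-hand side.
  Solvability of the second and third component comes from \<open>lam \<in> \<rho>(\<A>\<^sub>0)\<close>; the norm of \<open>h\<close> is
  bounded by the resolvent estimate for \<open>lam \<in> \<rho>(\<A>\<^sup>\<delta>\<^sup>0)\<close>, with \<open>L \<phi>\<close> treated as part of the data.
\<close>


section \<open>Strongly measurable functions and \<open>L\<^sup>p\<close>\<close>

text \<open>The two a priori inequalities \<open>halfline_value_at_zero\<close> and
  \<open>delay_value_bound\<close> are stated for an arbitrary residual, not for exact solutions, so
  each is used twice. A residual of norm 0 turns them into the exact values of \<open>h 0\<close>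
  and \<open>\<phi>\<close> that surjectivity requires; a general residual gives the estimates
  behind the lower bounds. The obstacle is regularity. The space is not assumed separable, the
  derivative in \<open>W1p\<close> is known only through its Henstock-Kurzweil integrals, and the
  resolvent equations hold only almost everywhere. Hence no Laplace transform of the datum
  \<open>f\<close> is formed. It enters through its primitive alone, whose norm at t is at most (1 +
  t) times the L^p norm of \<open>f\<close>; because Re lam > 0, the exponential weight beats this
  linear growth, and that is where the constants come from. Evaluation at 0 makes sense because
  elements of \<open>W1p\<close> are continuous representatives.\<close>

lemma simple_fun_leb_compose2:
  fixes H :: "'b::real_normed_vector \<Rightarrow> 'c::real_normed_vector \<Rightarrow> 'd::real_normed_vector"
  assumes s: "simple_fun_leb s" and s': "simple_fun_leb s'"
  shows "simple_fun_leb (\<lambda>t. H (s t) (s' t))"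
  unfolding simple_fun_leb_def
proof (intro conjI allI)
  have fin: "finite (range s \<times> range s')"
    using s s' by (auto simp: simple_fun_leb_def)
  have "range (\<lambda>t. H (s t) (s' t)) \<subseteq> (\<lambda>(u, v). H u v) ` (range s \<times> range s')"
    by auto
  then show "finite (range (\<lambda>t. H (s t) (s' t)))"
    using fin finite_subset by blast
  fix c
  \<comment> \<open>The pair of values ranges over a finite set, so the level set is a finite union
    of intersections of level sets, whatever \<open>H\<close> is.\<close>
  have "(\<lambda>t. H (s t) (s' t)) -` {c} =
      (\<Union>(u, v) \<in> {(u, v) \<in> range s \<times> range s'. H u v = c}. s -` {u} \<inter> s' -` {v})"
    by auto
  also have "\<dots> \<in> sets lebesgue"
    using s s' by (intro sets.finite_UN finite_subset[OF _ fin]) (auto simp: simple_fun_leb_def)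
  finally show "(\<lambda>t. H (s t) (s' t)) -` {c} \<in> sets lebesgue" .
qed

lemma strongly_measurable_on_compose2:
  fixes H :: "'b::real_normed_vector \<Rightarrow> 'c::real_normed_vector \<Rightarrow> 'd::real_normed_vector"
  assumes f: "strongly_measurable_on S f" and g: "strongly_measurable_on S g"
    and H: "continuous_on UNIV (\<lambda>(x, y). H x y)"
  shows "strongly_measurable_on S (\<lambda>t. H (f t) (g t))"
proof -
  obtain s where s: "\<And>n. simple_fun_leb (s n)"
      "AE t in lebesgue. t \<in> S \<longrightarrow> (\<lambda>n. s n t) \<longlonglongrightarrow> f t"
    using f by (auto simp: strongly_measurable_on_def)
  obtain s' where s': "\<And>n. simple_fun_leb (s' n)"
      "AE t in lebesgue. t \<in> S \<longrightarrow> (\<lambda>n. s' n t) \<longlonglongrightarrow> g t"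
    using g by (auto simp: strongly_measurable_on_def)
  have lim: "(\<lambda>n. H (u n) (v n)) \<longlonglongrightarrow> H x y" if "u \<longlonglongrightarrow> x" "v \<longlonglongrightarrow> y" for u v x y
    using continuous_on_tendsto_compose[OF H tendsto_Pair[OF that]] by simp
  show ?thesis
    unfolding strongly_measurable_on_def
  proof (intro exI[of _ "\<lambda>n t. H (s n t) (s' n t)"] conjI allI)
    show "AE t in lebesgue. t \<in> S \<longrightarrow> (\<lambda>n. H (s n t) (s' n t)) \<longlonglongrightarrow> H (f t) (g t)"
      using s(2) s'(2) by eventually_elim (auto intro: lim)
    show "simple_fun_leb (\<lambda>t. H (s n t) (s' n t))" for n
      by (rule simple_fun_leb_compose2[OF s(1) s'(1)])
  qed
qed

lemma strongly_measurable_on_compose: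
  fixes H :: "'b::real_normed_vector \<Rightarrow> 'd::real_normed_vector"
  assumes f: "strongly_measurable_on S f" and H: "continuous_on UNIV H"
  shows "strongly_measurable_on S (\<lambda>t. H (f t))"
proof -
  have "continuous_on UNIV (\<lambda>(x, y::'b). H x)"
    unfolding split_def by (rule continuous_on_compose2[OF H]) (auto intro: continuous_intros)
  from strongly_measurable_on_compose2[OF f f this] show ?thesis .
qed

lemma simple_function_imp_simple_fun_leb:
  assumes "simple_function lebesgue s"
  shows "simple_fun_leb s"
  unfolding simple_fun_leb_def
proof (intro conjI allI)
  show "finite (range s)"
    using assms by (simp add: simple_function_def)
  show "s -` {c} \<in> sets lebesgue" for c
  proof (cases "c \<in> range s")
    case True
    then show ?thesis using assms by (auto simp: simple_function_def)
  next
    case False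
    then have "s -` {c} = {}" by auto
    then show ?thesis by simp
  qed
qed

lemma borel_measurable_imp_strongly_measurable_on:
  fixes f :: "real \<Rightarrow> 'b::{real_normed_vector, second_countable_topology}"
  assumes f: "f \<in> borel_measurable lebesgue"
  shows "strongly_measurable_on S f"
proof -
  obtain F where "\<And>i. simple_function lebesgue (F i)" "\<And>x. (\<lambda>i. F i x) \<longlonglongrightarrow> f x"
    using borel_measurable_implies_sequence_metric[OF f, of 0] by auto
  then show ?thesis
    unfolding strongly_measurable_on_def
    by (intro exI[of _ F]) (auto intro: simple_function_imp_simple_fun_leb)
qed

text \<open>Passing to the real-valued norm makes Borel measurability available for values in a
  space that need not be separable: norms of simple functions are simple, and completeness of
  Lebesgue measure lets an a.e. limit stay measurable.\<close>

lemma strongly_measurable_on_norm_borel: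
  fixes f :: "real \<Rightarrow> 'b::real_normed_vector"
  assumes f: "strongly_measurable_on S f" and S: "S \<in> sets lebesgue"
  shows "(\<lambda>t. indicator S t * norm (f t)) \<in> borel_measurable lebesgue"
proof -
  obtain s where s: "\<And>n. simple_fun_leb (s n)"
      "AE t in lebesgue. t \<in> S \<longrightarrow> (\<lambda>n. s n t) \<longlonglongrightarrow> f t"
    using f by (auto simp: strongly_measurable_on_def)
  have sn: "simple_fun_leb (\<lambda>t. norm (s n t))" for n
    using simple_fun_leb_compose2[OF s(1) s(1), of "\<lambda>x y. norm x" n n] .
  have meas: "(\<lambda>t. norm (s n t)) \<in> borel_measurable lebesgue" for n
  proof (rule borel_measurable_simple_function)
    show "simple_function lebesgue (\<lambda>t. norm (s n t))"
      using sn[of n] by (auto simp: simple_fun_leb_def simple_function_def)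
  qed
  \<comment> \<open>\<open>lim\<close> is a total function and measurable in \<open>t\<close> even
    where the sequence diverges; almost everywhere it is the wanted limit.\<close>
  have "(\<lambda>t. lim (\<lambda>n. indicator S t * norm (s n t))) \<in> borel_measurable lebesgue"
    using meas S by measurable
  moreover have "AE t in lebesgue.
      lim (\<lambda>n. indicator S t * norm (s n t)) = indicator S t * norm (f t)"
    using s(2)
  proof eventually_elim
    case (elim t)
    then have "(\<lambda>n. indicator S t * norm (s n t)) \<longlonglongrightarrow> indicator S t * norm (f t)"
      by (cases "t \<in> S") (auto intro!: tendsto_norm)
    then show ?case by (rule limI)
  qed
  ultimately show ?thesis
    by (rule borel_measurable_AE)
qed

lemma strongly_measurable_on_norm_powr:
  fixes f :: "real \<Rightarrow> 'b::real_normed_vector"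
  assumes "strongly_measurable_on S f" and "S \<in> sets lebesgue"
  shows "(\<lambda>t. ennreal (norm (f t) powr p) * indicator S t) \<in> borel_measurable lebesgue"
proof -
  note [measurable] = strongly_measurable_on_norm_borel[OF assms] assms(2)
  have "(\<lambda>t. ennreal ((indicator S t * norm (f t)) powr p) * indicator S t) \<in> borel_measurable lebesgue"
    by measurable
  also have "(\<lambda>t. ennreal ((indicator S t * norm (f t)) powr p) * indicator S t) =
      (\<lambda>t. ennreal (norm (f t) powr p) * indicator S t)"
    by (auto simp: indicator_def)
  finally show ?thesis .
qed

section \<open>Sums, images and restrictions of L^p functions\<close>

lemma norm_add_powr_le:
  fixes x y :: "'b::real_normed_vector"
  assumes "0 \<le> p"
  shows "norm (x + y) powr p \<le> 2 powr p * (norm x powr p + norm y powr p)"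
proof -
  \<comment> \<open>Both norms are at most their maximum. The resulting constant is crude, which is
    harmless since the inequality only serves to show that an integral is finite.\<close>
  have "norm (x + y) powr p \<le> (2 * max (norm x) (norm y)) powr p"
    using norm_triangle_ineq[of x y] assms by (intro powr_mono2) (auto simp: max_def)
  also have "\<dots> = 2 powr p * max (norm x) (norm y) powr p"
    by (simp add: powr_mult)
  also have "\<dots> \<le> 2 powr p * (norm x powr p + norm y powr p)"
    by (intro mult_left_mono) (auto simp: max_def)
  finally show ?thesis .
qed

lemma Lp_add:
  fixes f g :: "real \<Rightarrow> 'b::real_normed_vector"
  assumes p: "0 \<le> p" and S: "S \<in> sets lebesgue" and f: "Lp p S f" and g: "Lp p S g"
  shows "Lp p S (\<lambda>t. f t + g t)"
  unfolding Lp_def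
proof
  have sf: "strongly_measurable_on S f" and sg: "strongly_measurable_on S g"
    using f g by (auto simp: Lp_def)
  show "strongly_measurable_on S (\<lambda>t. f t + g t)"
    using strongly_measurable_on_compose2[OF sf sg, of "(+)"]
    by (simp add: split_def continuous_on_add continuous_on_fst continuous_on_snd)
  have "(\<integral>\<^sup>+ t\<in>S. ennreal (norm (f t + g t) powr p) \<partial>lebesgue) \<le>
      (\<integral>\<^sup>+ t. ennreal (2 powr p) * (ennreal (norm (f t) powr p) * indicator S t
         + ennreal (norm (g t) powr p) * indicator S t) \<partial>lebesgue)"
  proof (intro nn_integral_mono)
    fix t
    have "ennreal (norm (f t + g t) powr p) \<le>
        ennreal (2 powr p * (norm (f t) powr p + norm (g t) powr p))"
      by (intro ennreal_leI norm_add_powr_le p)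
    also have "\<dots> = ennreal (2 powr p) * (ennreal (norm (f t) powr p) + ennreal (norm (g t) powr p))"
      by (simp add: ennreal_mult)
    finally show "ennreal (norm (f t + g t) powr p) * indicator S t \<le> ennreal (2 powr p) *
        (ennreal (norm (f t) powr p) * indicator S t + ennreal (norm (g t) powr p) * indicator S t)"
      by (cases "t \<in> S") auto
  qed
  also have "\<dots> = ennreal (2 powr p) * ((\<integral>\<^sup>+ t\<in>S. ennreal (norm (f t) powr p) \<partial>lebesgue)
       + (\<integral>\<^sup>+ t\<in>S. ennreal (norm (g t) powr p) \<partial>lebesgue))"
    using strongly_measurable_on_norm_powr[OF sf S, of p] strongly_measurable_on_norm_powr[OF sg S, of p]
    by (subst nn_integral_cmult) (auto simp: nn_integral_add)
  also have "\<dots> < \<infinity>"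
    using f g by (simp add: Lp_def ennreal_mult_less_top)
  finally show "(\<integral>\<^sup>+ t\<in>S. ennreal (norm (f t + g t) powr p) \<partial>lebesgue) < \<infinity>" .
qed

lemma Lp_compose:
  fixes f :: "real \<Rightarrow> 'b::real_normed_vector" and H :: "'b \<Rightarrow> 'c::real_normed_vector"
  assumes p: "0 \<le> p" and S: "S \<in> sets lebesgue" and f: "Lp p S f"
    and H: "continuous_on UNIV H" "\<And>x. norm (H x) \<le> K * norm x"
  shows "Lp p S (\<lambda>t. H (f t))"
  unfolding Lp_def
proof
  have sf: "strongly_measurable_on S f"
    using f by (auto simp: Lp_def)
  show "strongly_measurable_on S (\<lambda>t. H (f t))"
    by (rule strongly_measurable_on_compose[OF sf H(1)])
  \<comment> \<open>Nothing forces \<open>K\<close> to be nonnegative, and \<open>powr\<close> is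
    monotone only on nonnegative bases; hence the absolute value.\<close>
  have "norm (H x) powr p \<le> \<bar>K\<bar> powr p * norm x powr p" for x
  proof -
    have "norm (H x) \<le> \<bar>K\<bar> * norm x"
      by (rule order_trans[OF H(2)]) (intro mult_right_mono, auto)
    then have "norm (H x) powr p \<le> (\<bar>K\<bar> * norm x) powr p"
      using p by (intro powr_mono2) auto
    then show ?thesis by (simp add: powr_mult)
  qed
  then have "(\<integral>\<^sup>+ t\<in>S. ennreal (norm (H (f t)) powr p) \<partial>lebesgue) \<le>
      (\<integral>\<^sup>+ t. ennreal (\<bar>K\<bar> powr p) * (ennreal (norm (f t) powr p) * indicator S t) \<partial>lebesgue)"
    by (intro nn_integral_mono) (auto simp: indicator_def ennreal_mult'[symmetric] intro!: ennreal_leI)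
  also have "\<dots> = ennreal (\<bar>K\<bar> powr p) * (\<integral>\<^sup>+ t\<in>S. ennreal (norm (f t) powr p) \<partial>lebesgue)"
    by (intro nn_integral_cmult strongly_measurable_on_norm_powr sf S)
  also have "\<dots> < \<infinity>"
    using f by (simp add: Lp_def ennreal_mult_less_top)
  finally show "(\<integral>\<^sup>+ t\<in>S. ennreal (norm (H (f t)) powr p) \<partial>lebesgue) < \<infinity>" .
qed

lemma Lp_diff:
  fixes f g :: "real \<Rightarrow> 'b::real_normed_vector"
  assumes "0 \<le> p" "S \<in> sets lebesgue" "Lp p S f" "Lp p S g"
  shows "Lp p S (\<lambda>t. f t - g t)"
  using Lp_add[OF assms(1-3) Lp_compose[OF assms(1,2,4), of uminus 1]]
  by (simp add: continuous_on_minus)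

lemma Lp_zero: "Lp p S (\<lambda>t. 0 :: 'b::real_normed_vector)"
proof -
  have "strongly_measurable_on S (\<lambda>t. 0 :: 'b)"
    unfolding strongly_measurable_on_def
    by (intro exI[of _ "\<lambda>n t. 0"]) (simp add: simple_fun_leb_def vimage_const)
  then show ?thesis by (simp add: Lp_def)
qed

lemma Lp_subset:
  fixes f :: "real \<Rightarrow> 'b::real_normed_vector"
  assumes f: "Lp p S f" and "S' \<subseteq> S"
  shows "Lp p S' f"
proof -
  have "strongly_measurable_on S' f"
  proof -
    obtain s where s: "\<And>n. simple_fun_leb (s n)"
      "AE t in lebesgue. t \<in> S \<longrightarrow> (\<lambda>n. s n t) \<longlonglongrightarrow> f t"
      using f by (auto simp: strongly_measurable_on_def Lp_def)
    then show ?thesis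
      unfolding strongly_measurable_on_def
      using assms(2) by (intro exI[of _ s]) (auto elim: AE_mp)
  qed
  moreover have "(\<integral>\<^sup>+ t\<in>S'. ennreal (norm (f t) powr p) \<partial>lebesgue) \<le>
      (\<integral>\<^sup>+ t\<in>S. ennreal (norm (f t) powr p) \<partial>lebesgue)"
    using assms(2) by (intro nn_integral_mono) (auto simp: indicator_def)
  ultimately show ?thesis
    using f by (auto simp: Lp_def)
qed

section \<open>The L^p seminorm and integrals over bounded intervals\<close>

lemma Lp_norm_nonneg [simp]: "0 \<le> Lp_norm p S f"
  by (simp add: Lp_norm_def)

lemma nn_integral_eq_Lp_norm:
  assumes "Lp p S f" "0 < p"
  shows "(\<integral>\<^sup>+ t\<in>S. ennreal (norm (f t) powr p) \<partial>lebesgue) = ennreal (Lp_norm p S f powr p)"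
  using assms by (simp add: Lp_def Lp_norm_def powr_powr)

lemma Lp_norm_eq_0_iff:
  assumes "Lp p S f" "0 < p" "S \<in> sets lebesgue"
  shows "Lp_norm p S f = 0 \<longleftrightarrow> (AE t in lebesgue. t \<in> S \<longrightarrow> f t = 0)"
proof -
  have sm: "strongly_measurable_on S f"
    using assms by (auto simp: Lp_def)
  have "Lp_norm p S f = 0 \<longleftrightarrow> (\<integral>\<^sup>+ t\<in>S. ennreal (norm (f t) powr p) \<partial>lebesgue) = 0"
    unfolding nn_integral_eq_Lp_norm[OF assms(1,2)] by (simp add: ennreal_eq_0_iff)
  also have "\<dots> \<longleftrightarrow> (AE t in lebesgue. ennreal (norm (f t) powr p) * indicator S t = 0)"
    by (rule nn_integral_0_iff_AE[OF strongly_measurable_on_norm_powr[OF sm assms(3)]])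
  also have "\<dots> \<longleftrightarrow> (AE t in lebesgue. t \<in> S \<longrightarrow> f t = 0)"
    by (intro AE_cong) (auto simp: indicator_def ennreal_eq_0_iff)
  finally show ?thesis .
qed

lemma Lp_norm_eq_0I:
  assumes "AE t in lebesgue. t \<in> S \<longrightarrow> f t = 0"
  shows "Lp_norm p S f = 0"
proof -
  have "AE t in lebesgue. ennreal (norm (f t) powr p) * indicator S t = 0"
    using assms by eventually_elim auto
  from nn_integral_cong_AE[OF this] show ?thesis by (simp add: Lp_norm_def)
qed

lemma Lp_norm_le_sup:
  fixes f :: "real \<Rightarrow> 'b::real_normed_vector"
  assumes p: "0 < p" and ab: "a \<le> b" and B: "\<And>t. t \<in> {a..b} \<Longrightarrow> norm (f t) \<le> B"
  shows "Lp_norm p {a..b} f \<le> (b - a) powr (1 / p) * B"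
proof -
  have B0: "0 \<le> B"
    using B[of a] ab by (auto intro: order_trans[OF norm_ge_zero])
  have "(\<integral>\<^sup>+ t\<in>{a..b}. ennreal (norm (f t) powr p) \<partial>lebesgue) \<le>
      (\<integral>\<^sup>+ t. ennreal (B powr p) * indicator {a..b} t \<partial>lebesgue)"
    using B p by (intro nn_integral_mono) (auto simp: indicator_def intro!: ennreal_leI powr_mono2)
  also have "\<dots> = ennreal (B powr p * (b - a))"
    using ab by (simp add: nn_integral_cmult_indicator ennreal_mult)
  finally have "enn2real (\<integral>\<^sup>+ t\<in>{a..b}. ennreal (norm (f t) powr p) \<partial>lebesgue) \<le> B powr p * (b - a)"
    using ab by (intro enn2real_leI) auto
  then have "Lp_norm p {a..b} f \<le> (B powr p * (b - a)) powr (1 / p)"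
    unfolding Lp_norm_def using p by (intro powr_mono2) auto
  also have "\<dots> = (b - a) powr (1 / p) * B"
    using p ab B0 by (simp add: powr_mult powr_powr)
  finally show ?thesis .
qed

text \<open>Where \<open>u\<close> exceeds \<open>M\<close>, the quotient is at least 1 and is
  dominated by its own p-th power. Integrated over a bounded interval, this does the work of
  Hoelder's inequality.\<close>

lemma le_mult_one_plus_powr:
  fixes u M :: real
  assumes "1 \<le> p" "0 < M" "0 \<le> u"
  shows "u \<le> M + M * (u / M) powr p"
proof (cases "u \<le> M")
  case False
  then have "u / M \<le> (u / M) powr p"
    using assms powr_mono[of 1 p "u / M"] by simp
  then have "M * (u / M) \<le> M * (u / M) powr p"
    using assms by (intro mult_left_mono) auto
  then show ?thesis using assms by simp
next
  case True
  moreover have "0 \<le> M * (u / M) powr p"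
    using assms by simp
  ultimately show ?thesis by linarith
qed

text \<open>Integrating \<open>le_mult_one_plus_powr\<close> gives M (b - a) plus M^(1-p) times the
  p-th power of the seminorm, and the latter is at most \<open>M\<close>. A positive bound
  \<open>M\<close> stands in for the seminorm, which may vanish, because \<open>M\<close> is a
  divisor.\<close>

lemma Lp_nn_integral_bound:
  fixes f :: "real \<Rightarrow> 'b::real_normed_vector"
  assumes p: "1 \<le> p" and f: "Lp p S f" and sub: "{a..b} \<subseteq> S" and ab: "a \<le> b"
    and M: "0 < M" "Lp_norm p S f \<le> M"
  shows "(\<integral>\<^sup>+ t\<in>{a..b}. ennreal (norm (f t)) \<partial>lebesgue) \<le> ennreal (M * (1 + (b - a)))"
proof -
  have f': "Lp p {a..b} f"
    by (rule Lp_subset[OF f sub])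
  have "norm (f t) \<le> M + M * (norm (f t) / M) powr p" for t
    using p M by (intro le_mult_one_plus_powr) auto
  then have le: "norm (f t) \<le> M + M powr (1 - p) * norm (f t) powr p" for t
    using M by (simp add: powr_divide powr_diff field_simps)
  have "(\<integral>\<^sup>+ t\<in>{a..b}. ennreal (norm (f t)) \<partial>lebesgue) \<le>
      (\<integral>\<^sup>+ t. ennreal M * indicator {a..b} t +
         ennreal (M powr (1 - p)) * (ennreal (norm (f t) powr p) * indicator {a..b} t) \<partial>lebesgue)"
  proof (intro nn_integral_mono)
    fix t
    have "ennreal (norm (f t)) \<le> ennreal (M + M powr (1 - p) * norm (f t) powr p)"
      by (intro ennreal_leI le)
    also have "\<dots> = ennreal M + ennreal (M powr (1 - p)) * ennreal (norm (f t) powr p)"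
      using M by (simp add: ennreal_mult)
    finally show "ennreal (norm (f t)) * indicator {a..b} t \<le> ennreal M * indicator {a..b} t +
         ennreal (M powr (1 - p)) * (ennreal (norm (f t) powr p) * indicator {a..b} t)"
      by (cases "t \<in> {a..b}") auto
  qed
  also have "\<dots> = ennreal (M * (b - a)) + ennreal (M powr (1 - p)) *
      (\<integral>\<^sup>+ t\<in>{a..b}. ennreal (norm (f t) powr p) \<partial>lebesgue)"
  proof -
    have [measurable]: "(\<lambda>t. ennreal (norm (f t) powr p) * indicator {a..b} t) \<in> borel_measurable lebesgue"
      using f' by (intro strongly_measurable_on_norm_powr) (auto simp: Lp_def)
    have [measurable]: "{a..b} \<in> sets lebesgue"
      by simp
    have 1: "(\<integral>\<^sup>+ t. ennreal M * indicator {a..b} t \<partial>lebesgue) = ennreal (M * (b - a))"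
      using M ab by (simp add: nn_integral_cmult_indicator ennreal_mult)
    have 2: "(\<integral>\<^sup>+ t. ennreal (M powr (1 - p)) * (ennreal (norm (f t) powr p) * indicator {a..b} t) \<partial>lebesgue)
        = ennreal (M powr (1 - p)) * (\<integral>\<^sup>+ t\<in>{a..b}. ennreal (norm (f t) powr p) \<partial>lebesgue)"
      by (rule nn_integral_cmult) measurable
    show ?thesis
      unfolding 1[symmetric] 2[symmetric] by (rule nn_integral_add) measurable
  qed
  also have "\<dots> \<le> ennreal (M * (b - a)) + ennreal (M powr (1 - p)) *
      (\<integral>\<^sup>+ t\<in>S. ennreal (norm (f t) powr p) \<partial>lebesgue)"
    using sub by (intro add_left_mono mult_left_mono nn_integral_mono) (auto simp: indicator_def)
  also have "\<dots> = ennreal (M * (b - a)) + ennreal (M powr (1 - p)) * ennreal (Lp_norm p S f powr p)"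
    using nn_integral_eq_Lp_norm[OF f] p by simp
  also have "\<dots> \<le> ennreal (M * (b - a)) + ennreal (M powr (1 - p)) * ennreal (M powr p)"
    using M p by (intro add_left_mono mult_left_mono ennreal_leI powr_mono2) auto
  also have "\<dots> = ennreal (M * (b - a) + M)"
    using M ab by (simp add: ennreal_mult'[symmetric] powr_add[symmetric])
  finally show ?thesis by (simp add: algebra_simps)
qed

text \<open>The codomain need not be separable, so Bochner integration is not available; the
  Henstock--Kurzweil integral is bounded through the scalar function \<open>norm \<circ> f\<close>.\<close>

lemma norm_integral_le_Lp_norm:
  fixes f :: "real \<Rightarrow> 'b::banach"
  assumes p: "1 \<le> p" and f: "Lp p S f" and sub: "{a..b} \<subseteq> S" and ab: "a \<le> b"
    and int: "f integrable_on {a..b}"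
  shows "norm (integral {a..b} f) \<le> (1 + (b - a)) * Lp_norm p S f"
proof -
  have bound: "norm (integral {a..b} f) \<le> (1 + (b - a)) * M" if M: "0 < M" "Lp_norm p S f \<le> M" for M
  proof -
    have meas: "(\<lambda>t. indicator {a..b} t * norm (f t)) \<in> borel_measurable lebesgue"
      using Lp_subset[OF f sub] by (intro strongly_measurable_on_norm_borel) (auto simp: Lp_def)
    \<comment> \<open>Finiteness of this integral makes the norm of \<open>f\<close>
      Henstock-Kurzweil integrable, so that it can majorise the vector-valued integral.\<close>
    define I where "I = (\<integral>\<^sup>+ t. ennreal (indicator {a..b} t * norm (f t)) \<partial>lebesgue)"
    have "I = (\<integral>\<^sup>+ t\<in>{a..b}. ennreal (norm (f t)) \<partial>lebesgue)"
      unfolding I_def by (intro nn_integral_cong) (auto simp: indicator_def)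
    then have I: "I \<le> ennreal (M * (1 + (b - a)))"
      using Lp_nn_integral_bound[OF p f sub ab M] by simp
    then have "I < \<infinity>"
      using ennreal_less_top le_less_trans by (metis infinity_ennreal_def)
    then have Ir: "I = ennreal (enn2real I)"
      by simp
    have "((\<lambda>t. indicator {a..b} t * norm (f t)) has_integral enn2real I) UNIV"
      using meas Ir unfolding I_def by (subst has_integral_iff_nn_integral_lebesgue) auto
    then have "((\<lambda>t. if t \<in> {a..b} then norm (f t) else 0) has_integral enn2real I) UNIV"
      by (rule has_integral_eq[rotated]) (auto simp: indicator_def)
    then have hi: "((\<lambda>t. norm (f t)) has_integral enn2real I) {a..b}"
      by (simp only: has_integral_restrict_UNIV)
    have "norm (integral {a..b} f) \<le> integral {a..b} (\<lambda>t. norm (f t))"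
      by (rule Henstock_Kurzweil_Integration.integral_norm_bound_integral[OF int])
        (use has_integral_integrable[OF hi] in auto)
    also have "\<dots> = enn2real I"
      using hi by (rule integral_unique)
    also have "\<dots> \<le> M * (1 + (b - a))"
      using I M ab by (intro enn2real_leI) auto
    finally show ?thesis by (simp add: mult.commute)
  qed
  show ?thesis
  proof (rule field_le_epsilon)
    fix e :: real assume e: "0 < e"
    \<comment> \<open>\<open>bound\<close> asks for a positive \<open>M\<close>, so the seminorm is
      enlarged by the amount that adds exactly \<open>e\<close>.\<close>
    have "norm (integral {a..b} f) \<le> (1 + (b - a)) * (Lp_norm p S f + e / (1 + (b - a)))"
      using e ab by (intro bound) (auto intro: add_nonneg_pos)
    also have "\<dots> = (1 + (b - a)) * Lp_norm p S f + e"
      using ab by (simp add: field_simps)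
    finally show "norm (integral {a..b} f) \<le> (1 + (b - a)) * Lp_norm p S f + e" .
  qed
qed

section \<open>Translation and extension by zero\<close>

lemma simple_fun_leb_translate:
  assumes "simple_fun_leb s"
  shows "simple_fun_leb (\<lambda>t. s (t + c))"
  unfolding simple_fun_leb_def
proof (intro conjI allI)
  show "finite (range (\<lambda>t. s (t + c)))"
    using assms by (auto simp: simple_fun_leb_def elim: finite_subset[rotated])
  fix v
  have "(\<lambda>t. s (t + c)) -` {v} = (+) (- c) ` (s -` {v})"
    by (auto simp: image_iff intro!: bexI[of _ "_ + c"])
  then show "(\<lambda>t. s (t + c)) -` {v} \<in> sets lebesgue"
    using assms by (simp only: simple_fun_leb_def lebesgue_sets_translation)
qed

lemma AE_lebesgue_translate:
  fixes c :: real
  assumes "AE t in lebesgue. P t"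
  shows "AE t in lebesgue. P (t + c)"
proof -
  have "negligible {t. \<not> P t}"
    using assms by (simp add: completion.AE_iff_null_sets negligible_iff_null_sets)
  then have "negligible ((+) (- c) ` {t. \<not> P t})"
    by (rule negligible_translation)
  also have "(+) (- c) ` {t. \<not> P t} = {t. \<not> P (t + c)}"
    by (auto simp: image_iff intro!: exI[of _ "_ + c"])
  finally show ?thesis
    by (simp add: completion.AE_iff_null_sets negligible_iff_null_sets)
qed

lemma Lp_translate:
  fixes f :: "real \<Rightarrow> 'b::real_normed_vector"
  assumes f: "Lp p S f" and S: "S \<in> sets lebesgue"
  shows "Lp p {t. t + c \<in> S} (\<lambda>t. f (t + c))"
  unfolding Lp_def
proof
  obtain s where s: "\<And>n. simple_fun_leb (s n)"
      "AE t in lebesgue. t \<in> S \<longrightarrow> (\<lambda>n. s n t) \<longlonglongrightarrow> f t"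
    using f by (auto simp: strongly_measurable_on_def Lp_def)
  then show "strongly_measurable_on {t. t + c \<in> S} (\<lambda>t. f (t + c))"
    unfolding strongly_measurable_on_def
    using AE_lebesgue_translate[OF s(2), of c] simple_fun_leb_translate[OF s(1)]
    by (intro exI[of _ "\<lambda>n t. s n (t + c)"]) auto
  have "(\<integral>\<^sup>+ t\<in>S. ennreal (norm (f t) powr p) \<partial>lebesgue) =
      (\<integral>\<^sup>+ t. ennreal (norm (f (t + c)) powr p) * indicator S (t + c) \<partial>lebesgue)"
    using nn_integral_real_affine_lebesgue[OF strongly_measurable_on_norm_powr[OF _ S, of f p], of 1 c] f
    by (simp add: Lp_def add.commute[of c])
  also have "\<dots> = (\<integral>\<^sup>+ t\<in>{t. t + c \<in> S}. ennreal (norm (f (t + c)) powr p) \<partial>lebesgue)"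
    by (intro nn_integral_cong) (auto simp: indicator_def)
  finally show "(\<integral>\<^sup>+ t\<in>{t. t + c \<in> S}. ennreal (norm (f (t + c)) powr p) \<partial>lebesgue) < \<infinity>"
    using f by (simp add: Lp_def)
qed

lemma Lp_extend_by_zero:
  fixes f :: "real \<Rightarrow> 'b::real_normed_vector"
  assumes f: "Lp p S f" and S: "S \<in> sets lebesgue"
  shows "Lp p S' (\<lambda>t. if t \<in> S then f t else 0)"
  unfolding Lp_def
proof
  obtain s where s: "\<And>n. simple_fun_leb (s n)"
      "AE t in lebesgue. t \<in> S \<longrightarrow> (\<lambda>n. s n t) \<longlonglongrightarrow> f t"
    using f by (auto simp: strongly_measurable_on_def Lp_def)
  have ind: "simple_fun_leb (indicator S :: real \<Rightarrow> real)"
    using S by (intro simple_function_imp_simple_fun_leb simple_function_indicator) auto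
  have "AE t in lebesgue. t \<in> S' \<longrightarrow>
      (\<lambda>n. (indicator S t :: real) *\<^sub>R s n t) \<longlonglongrightarrow> (if t \<in> S then f t else 0)"
    using s(2) by eventually_elim auto
  moreover have "simple_fun_leb (\<lambda>t. (indicator S t :: real) *\<^sub>R s n t)" for n
    by (rule simple_fun_leb_compose2[OF ind s(1)])
  ultimately show "strongly_measurable_on S' (\<lambda>t. if t \<in> S then f t else 0)"
    unfolding strongly_measurable_on_def
    by (intro exI[of _ "\<lambda>n t. (indicator S t :: real) *\<^sub>R s n t"]) auto
  have "(\<integral>\<^sup>+ t\<in>S'. ennreal (norm (if t \<in> S then f t else 0) powr p) \<partial>lebesgue) \<le>
     (\<integral>\<^sup>+ t\<in>S. ennreal (norm (f t) powr p) \<partial>lebesgue)"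
    by (intro nn_integral_mono) (auto simp: indicator_def)
  then show "(\<integral>\<^sup>+ t\<in>S'. ennreal (norm (if t \<in> S then f t else 0) powr p) \<partial>lebesgue) < \<infinity>"
    using f by (auto simp: Lp_def)
qed

section \<open>The Riemann--Stieltjes integral of a continuous function\<close>

text \<open>The premise of \<open>has_RS_integral_def\<close>, clause by clause, so that
  \<open>has_RS_integral_iff\<close> is pure unfolding. Points may repeat, and for
  \<open>a = b\<close> a single point is a partition.\<close>

definition fine_tagged :: "real \<Rightarrow> real \<Rightarrow> real \<Rightarrow> real list \<Rightarrow> real list \<Rightarrow> bool" where
  "fine_tagged a b \<delta> xs ts \<longleftrightarrow>
     xs \<noteq> [] \<and> hd xs = a \<and> last xs = b \<and> sorted xs \<and>
     (\<forall>i<length xs - 1. xs ! Suc i - xs ! i < \<delta>) \<and>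
     length ts = length xs - 1 \<and>
     (\<forall>i<length ts. xs ! i \<le> ts ! i \<and> ts ! i \<le> xs ! Suc i)"

definition RS_sum ::
  "(real \<Rightarrow> 'a::real_normed_vector \<Rightarrow>\<^sub>L 'a) \<Rightarrow> (real \<Rightarrow> 'a) \<Rightarrow> real list \<Rightarrow> real list \<Rightarrow> 'a" where
  "RS_sum \<mu> \<phi> xs ts =
     (\<Sum>i<length ts. blinfun_apply (\<mu> (xs ! Suc i) - \<mu> (xs ! i)) (\<phi> (ts ! i)))"

lemma has_RS_integral_iff:
  "has_RS_integral \<mu> \<phi> a b I \<longleftrightarrow>
     (\<forall>\<epsilon>>0. \<exists>\<delta>>0. \<forall>xs ts. fine_tagged a b \<delta> xs ts \<longrightarrow> norm (RS_sum \<mu> \<phi> xs ts - I) < \<epsilon>)"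
  unfolding has_RS_integral_def fine_tagged_def RS_sum_def ..

lemma fine_tagged_mono: "fine_tagged a b \<delta> xs ts \<Longrightarrow> \<delta> \<le> \<delta>' \<Longrightarrow> fine_tagged a b \<delta>' xs ts"
  unfolding fine_tagged_def by force

lemma fine_tagged_points:
  assumes "fine_tagged a b \<delta> xs ts"
  shows "set xs \<subseteq> {a..b}"
proof
  fix x assume "x \<in> set xs"
  then obtain i where i: "i < length xs" "x = xs ! i"
    by (auto simp: in_set_conv_nth)
  have "xs ! 0 \<le> xs ! i" "xs ! i \<le> xs ! (length xs - 1)"
    using assms i by (auto simp: fine_tagged_def intro!: sorted_nth_mono)
  then show "x \<in> {a..b}"
    using assms i by (auto simp: fine_tagged_def hd_conv_nth last_conv_nth)
qed

lemma fine_tagged_tags: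
  assumes "fine_tagged a b \<delta> xs ts" "i < length ts"
  shows "ts ! i \<in> {a..b}"
proof -
  have "xs ! i \<in> set xs" "xs ! Suc i \<in> set xs"
    using assms by (auto simp: fine_tagged_def)
  then have "a \<le> xs ! i" "xs ! Suc i \<le> b"
    using fine_tagged_points[OF assms(1)] by auto
  moreover have "xs ! i \<le> ts ! i" "ts ! i \<le> xs ! Suc i"
    using assms by (auto simp: fine_tagged_def)
  ultimately show ?thesis by auto
qed

lemma ex_fine_tagged:
  assumes ab: "a \<le> b" and \<delta>: "0 < \<delta>"
  shows "\<exists>xs ts. fine_tagged a b \<delta> xs ts"
proof -
  \<comment> \<open>The inequality is strict: it pushes the mesh of the equidistant partition below
    \<open>\<delta>\<close> and makes \<open>n\<close> positive even if
    \<open>a = b\<close>.\<close>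
  obtain n :: nat where n: "(b - a) / \<delta> < real n"
    using reals_Archimedean2 by blast
  moreover have "0 \<le> (b - a) / \<delta>"
    using ab \<delta> by simp
  ultimately have "0 < real n" by linarith
  then have n0: "0 < n" by simp
  define x where "x i = a + (b - a) * real i / real n" for i
  have step: "x (Suc i) = x i + (b - a) / real n" for i
    using n0 by (simp add: x_def field_simps)
  have mono: "x i \<le> x j" if "i \<le> j" for i j
    using that ab n0 by (auto simp: x_def intro!: divide_right_mono mult_left_mono)
  have mesh: "(b - a) / real n < \<delta>"
    using n n0 \<delta> by (simp add: field_simps)
  have nth: "map x [0..<Suc n] ! i = x i" if "i \<le> n" for i
    using that by (simp del: upt_Suc)
  have "fine_tagged a b \<delta> (map x [0..<Suc n]) (map x [0..<n])"
    unfolding fine_tagged_def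
  proof (intro conjI)
    show "hd (map x [0..<Suc n]) = a"
      by (simp add: hd_map x_def del: upt_Suc)
    show "last (map x [0..<Suc n]) = b"
      using n0 by (simp add: x_def)
    show "sorted (map x [0..<Suc n])"
      by (auto simp: sorted_iff_nth_mono mono simp del: upt_Suc)
    show "\<forall>i<length (map x [0..<Suc n]) - 1.
        map x [0..<Suc n] ! Suc i - map x [0..<Suc n] ! i < \<delta>"
      using mesh by (auto simp: nth step simp del: upt_Suc)
    show "\<forall>i<length (map x [0..<n]). map x [0..<Suc n] ! i \<le> map x [0..<n] ! i \<and>
        map x [0..<n] ! i \<le> map x [0..<Suc n] ! Suc i"
      by (auto simp: nth mono simp del: upt_Suc)
  qed auto
  then show ?thesis by blast
qed

lemma bounded_variation_onE:
  assumes "bounded_variation_on \<mu> a b"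
  obtains V where "0 \<le> V" "\<And>xs. sorted xs \<Longrightarrow> set xs \<subseteq> {a..b} \<Longrightarrow> partition_var \<mu> xs \<le> V"
proof -
  obtain V where V: "\<And>xs. sorted xs \<Longrightarrow> set xs \<subseteq> {a..b} \<Longrightarrow> partition_var \<mu> xs \<le> V"
    using assms unfolding bounded_variation_on_def bdd_above_def by blast
  \<comment> \<open>The empty list has variation 0, which \<open>V\<close> must dominate.\<close>
  have "0 \<le> V"
    using V[of "[]"] by (simp add: partition_var_def)
  with V show ?thesis by (rule that[rotated])
qed

text \<open>Steps of zero length contribute nothing, so \<open>v\<close> is bounded at proper steps
  only. This matters for a merged partition: it repeats the left end point, which lies in none of
  the left-open cells of \<open>tag_step\<close>.\<close>

lemma sum_blinfun_norm_le:
  fixes \<mu> :: "real \<Rightarrow> 'a::real_normed_vector \<Rightarrow>\<^sub>L 'a"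
  assumes V: "partition_var \<mu> xs \<le> V" and B: "0 \<le> B"
    and v: "\<And>i. i < length xs - 1 \<Longrightarrow> xs ! Suc i \<noteq> xs ! i \<Longrightarrow> norm (v i) \<le> B"
  shows "norm (\<Sum>i<length xs - 1. blinfun_apply (\<mu> (xs ! Suc i) - \<mu> (xs ! i)) (v i)) \<le> V * B"
proof -
  have "norm (\<Sum>i<length xs - 1. blinfun_apply (\<mu> (xs ! Suc i) - \<mu> (xs ! i)) (v i)) \<le>
      (\<Sum>i<length xs - 1. norm (\<mu> (xs ! Suc i) - \<mu> (xs ! i)) * B)"
  proof (intro sum_norm_le)
    fix i assume i: "i \<in> {..<length xs - 1}"
    show "norm (blinfun_apply (\<mu> (xs ! Suc i) - \<mu> (xs ! i)) (v i)) \<le> norm (\<mu> (xs ! Suc i) - \<mu> (xs ! i)) * B"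
    proof (cases "xs ! Suc i = xs ! i")
      case False
      then show ?thesis
        using v[of i] i by (intro order_trans[OF norm_blinfun] mult_left_mono) auto
    qed auto
  qed
  also have "\<dots> = partition_var \<mu> xs * B"
    by (simp add: partition_var_def sum_distrib_right)
  also have "\<dots> \<le> V * B"
    by (intro mult_right_mono V B)
  finally show ?thesis .
qed

lemma norm_RS_sum_le:
  assumes V: "\<And>xs. sorted xs \<Longrightarrow> set xs \<subseteq> {a..b} \<Longrightarrow> partition_var \<mu> xs \<le> V"
    and fine: "fine_tagged a b \<delta> xs ts"
    and B: "0 \<le> B" "\<And>t. t \<in> {a..b} \<Longrightarrow> norm (\<phi> t) \<le> B"
  shows "norm (RS_sum \<mu> \<phi> xs ts) \<le> V * B"
proof -
  have len: "length ts = length xs - 1" and "sorted xs"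
    using fine by (auto simp: fine_tagged_def)
  then have "partition_var \<mu> xs \<le> V"
    using fine_tagged_points[OF fine] by (intro V)
  then show ?thesis
    unfolding RS_sum_def len
    by (rule sum_blinfun_norm_le[OF _ B(1)]) (use B(2) fine_tagged_tags[OF fine] len in auto)
qed

section \<open>Comparison of Riemann-Stieltjes sums on a common refinement\<close>

lemma sum_increments_between:
  fixes m :: "real \<Rightarrow> 'c::ab_group_add"
  assumes zs: "sorted zs" and c: "c \<in> set zs" and d: "d \<in> set zs" and cd: "c \<le> d"
  shows "(\<Sum>j<length zs - 1. if c < zs ! Suc j \<and> zs ! Suc j \<le> d
           then m (zs ! Suc j) - m (zs ! j) else 0) = m d - m c"
proof -
  obtain k where k: "k < length zs" "c = zs ! k"
    using c by (auto simp: in_set_conv_nth)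
  obtain l where l: "l < length zs" "d = zs ! l"
    using d by (auto simp: in_set_conv_nth)
  \<comment> \<open>Clamping the points to [c, d] makes every increment outside vanish, so the
    selected sum becomes a telescoping one.\<close>
  define M where "M j = m (max c (min d (zs ! j)))" for j
  have "(\<Sum>j<length zs - 1. if c < zs ! Suc j \<and> zs ! Suc j \<le> d then m (zs ! Suc j) - m (zs ! j) else 0)
      = (\<Sum>j<length zs - 1. M (Suc j) - M j)"
  proof (intro sum.cong refl)
    fix j assume j: "j \<in> {..<length zs - 1}"
    have le: "zs ! j \<le> zs ! Suc j"
      using j by (intro sorted_nth_mono[OF zs]) auto
    \<comment> \<open>Since \<open>c\<close> is itself in the list, no step can jump across it; the
      same holds for \<open>d\<close> below.\<close>
    have gt_c: "c \<le> zs ! j" if "c < zs ! Suc j"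
    proof -
      have "k < Suc j"
        using that k sorted_nth_mono[OF zs, of "Suc j" k] by (meson not_less)
      then show ?thesis
        using k j sorted_nth_mono[OF zs, of k j] by simp
    qed
    have gt_d: "d \<le> zs ! j" if "d < zs ! Suc j"
    proof -
      have "l < Suc j"
        using that l sorted_nth_mono[OF zs, of "Suc j" l] by (meson not_less)
      then show ?thesis
        using l j sorted_nth_mono[OF zs, of l j] by simp
    qed
    consider "zs ! Suc j \<le> c" | "c < zs ! Suc j" "zs ! Suc j \<le> d" | "d < zs ! Suc j"
      by linarith
    then show "(if c < zs ! Suc j \<and> zs ! Suc j \<le> d then m (zs ! Suc j) - m (zs ! j) else 0) = M (Suc j) - M j"
    proof cases
      case 1
      then have "max c (min d (zs ! j)) = c" "max c (min d (zs ! Suc j)) = c"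
        using le by (auto simp: max_def min_def)
      then show ?thesis using 1 by (simp add: M_def)
    next
      case 2
      then show ?thesis using le cd gt_c by (simp add: M_def max_def min_def)
    next
      case 3
      then show ?thesis using le cd gt_d by (simp add: M_def max_def min_def)
    qed
  qed
  also have "\<dots> = M (length zs - 1) - M 0"
    by (rule sum_lessThan_telescope)
  also have "M (length zs - 1) = m d"
    using l cd sorted_nth_mono[OF zs, of l "length zs - 1"] by (simp add: M_def max_def min_def)
  also have "M 0 = m c"
  proof -
    have "zs ! 0 \<le> c"
      using k sorted_nth_mono[OF zs, of 0 k] by simp
    then have "max c (min d (zs ! 0)) = c"
      by (auto simp: max_def min_def)
    then show ?thesis by (simp add: M_def)
  qed
  finally show ?thesis .
qed

text \<open>The left-continuous step function with value \<open>\<phi> (t\<^sub>i)\<close> on \<open>{x\<^sub>i<..x\<^sub>i\<^sub>+\<^sub>1}\<close>; it turns a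
  Riemann--Stieltjes sum into a sum over any refinement, so that two sums can be compared.\<close>

definition tag_step :: "(real \<Rightarrow> 'a::real_normed_vector) \<Rightarrow> real list \<Rightarrow> real list \<Rightarrow> real \<Rightarrow> 'a" where
  "tag_step \<phi> xs ts \<theta> = (\<Sum>i<length ts. if xs ! i < \<theta> \<and> \<theta> \<le> xs ! Suc i then \<phi> (ts ! i) else 0)"

text \<open>The increment of \<open>\<mu>\<close> over a cell of \<open>xs\<close> telescopes over
  the points of \<open>zs\<close> inside it. The step function is read at the right end of each
  small cell because its own cells are open on the left.\<close>

lemma RS_sum_refine:
  assumes fine: "fine_tagged a b \<delta> xs ts" and zs: "sorted zs" "set xs \<subseteq> set zs"
  shows "RS_sum \<mu> \<phi> xs ts =
    (\<Sum>j<length zs - 1. blinfun_apply (\<mu> (zs ! Suc j) - \<mu> (zs ! j)) (tag_step \<phi> xs ts (zs ! Suc j)))"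
proof -
  let ?P = "\<lambda>i j. xs ! i < zs ! Suc j \<and> zs ! Suc j \<le> xs ! Suc i"
  have "(\<Sum>j<length zs - 1. blinfun_apply (\<mu> (zs ! Suc j) - \<mu> (zs ! j)) (tag_step \<phi> xs ts (zs ! Suc j)))
     = (\<Sum>j<length zs - 1. \<Sum>i<length ts.
          blinfun_apply (if ?P i j then \<mu> (zs ! Suc j) - \<mu> (zs ! j) else 0) (\<phi> (ts ! i)))"
    unfolding tag_step_def by (intro sum.cong refl) (auto simp: blinfun.sum_right intro!: sum.cong)
  also have "\<dots> = (\<Sum>i<length ts. \<Sum>j<length zs - 1.
          blinfun_apply (if ?P i j then \<mu> (zs ! Suc j) - \<mu> (zs ! j) else 0) (\<phi> (ts ! i)))"
    by (rule sum.swap)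
  also have "\<dots> = (\<Sum>i<length ts. blinfun_apply (\<Sum>j<length zs - 1.
          if ?P i j then \<mu> (zs ! Suc j) - \<mu> (zs ! j) else 0) (\<phi> (ts ! i)))"
    by (simp only: blinfun.sum_left)
  also have "\<dots> = (\<Sum>i<length ts. blinfun_apply (\<mu> (xs ! Suc i) - \<mu> (xs ! i)) (\<phi> (ts ! i)))"
  proof (intro sum.cong refl)
    fix i assume "i \<in> {..<length ts}"
    then have i: "Suc i < length xs"
      using fine by (auto simp: fine_tagged_def)
    then have "xs ! i \<in> set zs" "xs ! Suc i \<in> set zs" "xs ! i \<le> xs ! Suc i"
      using zs fine by (auto simp: fine_tagged_def intro: sorted_nth_mono)
    from sum_increments_between[OF zs(1) this, of \<mu>]
    show "blinfun_apply (\<Sum>j<length zs - 1. if ?P i j then \<mu> (zs ! Suc j) - \<mu> (zs ! j) else 0) (\<phi> (ts ! i))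
       = blinfun_apply (\<mu> (xs ! Suc i) - \<mu> (xs ! i)) (\<phi> (ts ! i))"
      by simp
  qed
  finally show ?thesis by (simp add: RS_sum_def)
qed

lemma tag_step_near:
  assumes fine: "fine_tagged a b \<delta> xs ts" and \<theta>: "a < \<theta>" "\<theta> \<le> b"
  shows "\<exists>s\<in>{a..b}. \<bar>s - \<theta>\<bar> < \<delta> \<and> tag_step \<phi> xs ts \<theta> = \<phi> s"
proof -
  have xs: "xs \<noteq> []" "xs ! 0 = a" "xs ! (length xs - 1) = b" "sorted xs" "length ts = length xs - 1"
    using fine by (auto simp: fine_tagged_def hd_conv_nth last_conv_nth)
  have len: "2 \<le> length xs"
    using xs \<theta> by (cases xs; cases "tl xs") auto
  \<comment> \<open>The cell containing \<open>\<theta>\<close> is the first one whose right end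
    reaches \<open>\<theta>\<close>.\<close>
  define i where "i = (LEAST i. \<theta> \<le> xs ! Suc i)"
  have ex: "\<theta> \<le> xs ! Suc (length xs - 2)"
    using xs \<theta> len by (metis Suc_diff_Suc Suc_1 Suc_le_lessD diff_Suc_1')
  have le: "\<theta> \<le> xs ! Suc i"
    unfolding i_def using ex by (rule LeastI)
  have "i \<le> length xs - 2"
    unfolding i_def using ex by (rule Least_le)
  then have i: "Suc i < length xs"
    using len by linarith
  have before: "xs ! Suc j < \<theta>" if "j < i" for j
    using not_less_Least[of j "\<lambda>i. \<theta> \<le> xs ! Suc i"] that unfolding i_def by simp
  \<comment> \<open>For \<open>i = 0\<close> this is \<open>a < \<theta>\<close>; otherwise it is
    the minimality of \<open>i\<close>.\<close>
  have lt: "xs ! i < \<theta>"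
    using before[of "i - 1"] xs \<theta> by (cases i) auto
  have iff: "xs ! j < \<theta> \<and> \<theta> \<le> xs ! Suc j \<longleftrightarrow> j = i" if "j < length ts" for j
  proof
    assume j: "xs ! j < \<theta> \<and> \<theta> \<le> xs ! Suc j"
    have "\<not> j < i"
      using before[of j] j by auto
    moreover have "\<not> i < j"
    proof
      assume "i < j"
      then have "xs ! Suc i \<le> xs ! j"
        using that xs by (intro sorted_nth_mono) auto
      then show False using j le by simp
    qed
    ultimately show "j = i" by simp
  qed (use lt le in simp)
  have it: "i < length ts"
    using i xs by simp
  have "tag_step \<phi> xs ts \<theta> = (\<Sum>j<length ts. if j = i then \<phi> (ts ! i) else 0)"
    unfolding tag_step_def by (intro sum.cong refl) (use iff in auto)
  also have "\<dots> = \<phi> (ts ! i)"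
    using it by simp
  finally have "tag_step \<phi> xs ts \<theta> = \<phi> (ts ! i)" .
  moreover have "xs ! i \<le> ts ! i" "ts ! i \<le> xs ! Suc i" "xs ! Suc i - xs ! i < \<delta>"
    using fine it i by (auto simp: fine_tagged_def)
  then have "\<bar>ts ! i - \<theta>\<bar> < \<delta>"
    using lt le by linarith
  ultimately show ?thesis
    using fine_tagged_tags[OF fine it] by blast
qed

text \<open>On the merged partition both sums have the same increments of \<open>\<mu>\<close>. The
  two step values at a point are taken at tags less than \<open>\<delta>\<close> away from it, hence
  less than \<open>2 * \<delta>\<close> apart.\<close>

lemma RS_sum_Cauchy:
  assumes V: "0 \<le> V" "\<And>xs. sorted xs \<Longrightarrow> set xs \<subseteq> {a..b} \<Longrightarrow> partition_var \<mu> xs \<le> V"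
    and e: "0 \<le> e" "\<And>s s'. s \<in> {a..b} \<Longrightarrow> s' \<in> {a..b} \<Longrightarrow> \<bar>s - s'\<bar> < 2 * \<delta> \<Longrightarrow> norm (\<phi> s - \<phi> s') \<le> e"
    and xs: "fine_tagged a b \<delta> xs ts" and ys: "fine_tagged a b \<delta> ys us"
  shows "norm (RS_sum \<mu> \<phi> xs ts - RS_sum \<mu> \<phi> ys us) \<le> V * e"
proof -
  define zs where "zs = sort (xs @ ys)"
  have zs: "sorted zs" "set xs \<subseteq> set zs" "set ys \<subseteq> set zs" "set zs \<subseteq> {a..b}"
    using fine_tagged_points[OF xs] fine_tagged_points[OF ys] by (auto simp: zs_def)
  have "RS_sum \<mu> \<phi> xs ts - RS_sum \<mu> \<phi> ys us =
     (\<Sum>j<length zs - 1. blinfun_apply (\<mu> (zs ! Suc j) - \<mu> (zs ! j))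
        (tag_step \<phi> xs ts (zs ! Suc j) - tag_step \<phi> ys us (zs ! Suc j)))"
    unfolding RS_sum_refine[OF xs zs(1,2)] RS_sum_refine[OF ys zs(1,3)]
    by (simp add: blinfun.diff_right sum_subtractf)
  also have "norm \<dots> \<le> V * e"
  proof (rule sum_blinfun_norm_le[OF V(2) e(1)])
    fix j assume j: "j < length zs - 1" "zs ! Suc j \<noteq> zs ! j"
    have "zs ! j \<in> set zs" "zs ! Suc j \<in> set zs"
      using j by auto
    then have "zs ! j \<in> {a..b}" "zs ! Suc j \<in> {a..b}"
      using zs(4) by blast+
    moreover have "zs ! j \<le> zs ! Suc j"
      using j by (intro sorted_nth_mono zs) auto
    ultimately have \<theta>: "a < zs ! Suc j" "zs ! Suc j \<le> b"
      using j by auto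
    obtain s where s: "s \<in> {a..b}" "\<bar>s - zs ! Suc j\<bar> < \<delta>" "tag_step \<phi> xs ts (zs ! Suc j) = \<phi> s"
      using tag_step_near[OF xs \<theta>] by blast
    obtain s' where s': "s' \<in> {a..b}" "\<bar>s' - zs ! Suc j\<bar> < \<delta>" "tag_step \<phi> ys us (zs ! Suc j) = \<phi> s'"
      using tag_step_near[OF ys \<theta>] by blast
    have "\<bar>s - s'\<bar> < 2 * \<delta>"
      using s(2) s'(2) by linarith
    then show "norm (tag_step \<phi> xs ts (zs ! Suc j) - tag_step \<phi> ys us (zs ! Suc j)) \<le> e"
      unfolding s(3) s'(3) by (rule e(2)[OF s(1) s'(1)])
  qed (use zs in auto)
  finally show ?thesis .
qed

lemma has_RS_integral_exists:
  fixes \<mu> :: "real \<Rightarrow> 'a::banach \<Rightarrow>\<^sub>L 'a"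
  assumes ab: "a \<le> b" and bv: "bounded_variation_on \<mu> a b" and \<phi>: "continuous_on {a..b} \<phi>"
  shows "\<exists>I. has_RS_integral \<mu> \<phi> a b I"
proof -
  obtain V where V: "0 \<le> V" "\<And>xs. sorted xs \<Longrightarrow> set xs \<subseteq> {a..b} \<Longrightarrow> partition_var \<mu> xs \<le> V"
    using bounded_variation_onE[OF bv] by blast
  have Cauchy: "\<exists>\<delta>>0. \<forall>xs ts ys us. fine_tagged a b \<delta> xs ts \<longrightarrow> fine_tagged a b \<delta> ys us \<longrightarrow>
      norm (RS_sum \<mu> \<phi> xs ts - RS_sum \<mu> \<phi> ys us) < \<epsilon>" if \<epsilon>: "0 < \<epsilon>" for \<epsilon>
  proof -
    have uc: "uniformly_continuous_on {a..b} \<phi>"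
      using \<phi> by (rule compact_uniformly_continuous) simp
    \<comment> \<open>\<open>V + 1\<close> instead of \<open>V\<close>: the divisor must be positive
      and \<open>V\<close> times the quotient strictly below \<open>\<epsilon>\<close>.\<close>
    have e: "0 < \<epsilon> / (V + 1)"
      using \<epsilon> V by simp
    obtain d where d: "0 < d" "\<And>s s'. s \<in> {a..b} \<Longrightarrow> s' \<in> {a..b} \<Longrightarrow> dist s s' < d \<Longrightarrow> dist (\<phi> s) (\<phi> s') < \<epsilon> / (V + 1)"
      using uc e unfolding uniformly_continuous_on_def by meson
    have "norm (RS_sum \<mu> \<phi> xs ts - RS_sum \<mu> \<phi> ys us) < \<epsilon>"
      if "fine_tagged a b (d / 2) xs ts" "fine_tagged a b (d / 2) ys us" for xs ts ys us
    proof -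
      have "norm (RS_sum \<mu> \<phi> xs ts - RS_sum \<mu> \<phi> ys us) \<le> V * (\<epsilon> / (V + 1))"
        by (rule RS_sum_Cauchy[OF V _ _ that])
          (use e d(2) in \<open>auto simp: dist_norm less_imp_le\<close>)
      also have "\<dots> < \<epsilon>"
        using \<epsilon> V by (simp add: field_simps)
      finally show ?thesis .
    qed
    then show ?thesis
      using d(1) by (intro exI[of _ "d / 2"]) auto
  qed
  \<comment> \<open>The sums along one sequence of partitions with mesh tending to 0 form a Cauchy
    sequence; its limit is the candidate for the integral.\<close>
  have "\<forall>n::nat. \<exists>q. fine_tagged a b (1 / real (Suc n)) (fst q) (snd q)"
    using ex_fine_tagged[OF ab] by simp
  then obtain q where q: "\<And>n::nat. fine_tagged a b (1 / real (Suc n)) (fst (q n)) (snd (q n))"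
    by metis
  define S where "S n = RS_sum \<mu> \<phi> (fst (q n)) (snd (q n))" for n
  have q': "\<exists>N. \<forall>n\<ge>N. fine_tagged a b \<delta> (fst (q n)) (snd (q n))" if \<delta>: "0 < \<delta>" for \<delta>
  proof -
    obtain N :: nat where N: "1 / real (Suc N) < \<delta>"
      using \<delta> nat_approx_posE by blast
    have "fine_tagged a b \<delta> (fst (q n)) (snd (q n))" if "N \<le> n" for n
    proof (rule fine_tagged_mono[OF q])
      have "1 / real (Suc n) \<le> 1 / real (Suc N)"
        using that by (intro divide_left_mono) auto
      then show "1 / real (Suc n) \<le> \<delta>" using N by linarith
    qed
    then show ?thesis by blast
  qed
  have "Cauchy S"
  proof (rule CauchyI)
    fix \<epsilon> :: real assume "0 < \<epsilon>"
    then obtain \<delta> where \<delta>: "0 < \<delta>" "\<And>xs ts ys us. fine_tagged a b \<delta> xs ts \<Longrightarrow> fine_tagged a b \<delta> ys us \<Longrightarrow>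
      norm (RS_sum \<mu> \<phi> xs ts - RS_sum \<mu> \<phi> ys us) < \<epsilon>"
      using Cauchy by blast
    then show "\<exists>M. \<forall>m\<ge>M. \<forall>n\<ge>M. norm (S m - S n) < \<epsilon>"
      unfolding S_def using q'[OF \<delta>(1)] by metis
  qed
  then obtain I where I: "S \<longlonglongrightarrow> I"
    using Cauchy_convergent_iff convergent_def by blast
  have "has_RS_integral \<mu> \<phi> a b I"
    unfolding has_RS_integral_iff
  proof (intro allI impI)
    fix \<epsilon> :: real assume \<epsilon>: "0 < \<epsilon>"
    \<comment> \<open>Half of \<open>\<epsilon>\<close>, because passing to the limit in
      \<open>n\<close> preserves only the weak inequality.\<close>
    obtain \<delta> where \<delta>: "0 < \<delta>" "\<And>xs ts ys us. fine_tagged a b \<delta> xs ts \<Longrightarrow> fine_tagged a b \<delta> ys us \<Longrightarrow>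
      norm (RS_sum \<mu> \<phi> xs ts - RS_sum \<mu> \<phi> ys us) < \<epsilon> / 2"
      using Cauchy[of "\<epsilon> / 2"] \<epsilon> by auto
    obtain N where N: "\<And>n. N \<le> n \<Longrightarrow> fine_tagged a b \<delta> (fst (q n)) (snd (q n))"
      using q'[OF \<delta>(1)] by blast
    have "norm (RS_sum \<mu> \<phi> xs ts - I) < \<epsilon>" if "fine_tagged a b \<delta> xs ts" for xs ts
    proof -
      have "(\<lambda>n. norm (RS_sum \<mu> \<phi> xs ts - S n)) \<longlonglongrightarrow> norm (RS_sum \<mu> \<phi> xs ts - I)"
        by (intro tendsto_intros I)
      then have "norm (RS_sum \<mu> \<phi> xs ts - I) \<le> \<epsilon> / 2"
        by (rule Lim_bounded[of _ _ N])
          (use \<delta>(2)[OF that N] in \<open>auto simp: S_def less_imp_le\<close>)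
      then show ?thesis using \<epsilon> by linarith
    qed
    then show "\<exists>\<delta>>0. \<forall>xs ts. fine_tagged a b \<delta> xs ts \<longrightarrow> norm (RS_sum \<mu> \<phi> xs ts - I) < \<epsilon>"
      using \<delta>(1) by blast
  qed
  then show ?thesis by blast
qed

lemma has_RS_integral_norm_le:
  assumes ab: "a \<le> b" and I: "has_RS_integral \<mu> \<phi> a b I"
    and le: "\<And>\<delta> xs ts. fine_tagged a b \<delta> xs ts \<Longrightarrow> norm (RS_sum \<mu> \<phi> xs ts) \<le> K"
  shows "norm I \<le> K"
proof (rule field_le_epsilon)
  fix \<epsilon> :: real assume "0 < \<epsilon>"
  then obtain \<delta> where \<delta>: "0 < \<delta>" "\<And>xs ts. fine_tagged a b \<delta> xs ts \<Longrightarrow> norm (RS_sum \<mu> \<phi> xs ts - I) < \<epsilon>"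
    using I unfolding has_RS_integral_iff by blast
  obtain xs ts where q: "fine_tagged a b \<delta> xs ts"
    using ex_fine_tagged[OF ab \<delta>(1)] by blast
  have "norm I \<le> norm (RS_sum \<mu> \<phi> xs ts) + norm (RS_sum \<mu> \<phi> xs ts - I)"
    by (metis norm_triangle_sub norm_minus_commute)
  then show "norm I \<le> K + \<epsilon>"
    using \<delta>(2)[OF q] le[OF q] by linarith
qed

lemma has_RS_integral_add:
  assumes "has_RS_integral \<mu> \<phi> a b I" "has_RS_integral \<mu> \<psi> a b J"
  shows "has_RS_integral \<mu> (\<lambda>t. \<phi> t + \<psi> t) a b (I + J)"
  unfolding has_RS_integral_iff
proof (intro allI impI)
  fix \<epsilon> :: real assume \<epsilon>: "0 < \<epsilon>"
  obtain \<delta> where \<delta>: "0 < \<delta>" "\<And>xs ts. fine_tagged a b \<delta> xs ts \<Longrightarrow> norm (RS_sum \<mu> \<phi> xs ts - I) < \<epsilon> / 2"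
    using assms(1) \<epsilon> half_gt_zero unfolding has_RS_integral_iff by meson
  obtain \<delta>' where \<delta>': "0 < \<delta>'" "\<And>xs ts. fine_tagged a b \<delta>' xs ts \<Longrightarrow> norm (RS_sum \<mu> \<psi> xs ts - J) < \<epsilon> / 2"
    using assms(2) \<epsilon> half_gt_zero unfolding has_RS_integral_iff by meson
  have "norm (RS_sum \<mu> (\<lambda>t. \<phi> t + \<psi> t) xs ts - (I + J)) < \<epsilon>"
    if q: "fine_tagged a b (min \<delta> \<delta>') xs ts" for xs ts
  proof -
    have "RS_sum \<mu> (\<lambda>t. \<phi> t + \<psi> t) xs ts - (I + J) = (RS_sum \<mu> \<phi> xs ts - I) + (RS_sum \<mu> \<psi> xs ts - J)"
      by (simp add: RS_sum_def blinfun.add_right sum.distrib)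
    moreover have "norm (RS_sum \<mu> \<phi> xs ts - I) < \<epsilon> / 2" "norm (RS_sum \<mu> \<psi> xs ts - J) < \<epsilon> / 2"
      using \<delta>(2) \<delta>'(2) fine_tagged_mono[OF q] by auto
    ultimately show ?thesis
      by (metis norm_add_less field_sum_of_halves)
  qed
  then show "\<exists>\<delta>>0. \<forall>xs ts. fine_tagged a b \<delta> xs ts \<longrightarrow>
      norm (RS_sum \<mu> (\<lambda>t. \<phi> t + \<psi> t) xs ts - (I + J)) < \<epsilon>"
    using \<delta>(1) \<delta>'(1) by (intro exI[of _ "min \<delta> \<delta>'"]) auto
qed

lemma has_RS_integral_cong:
  assumes I: "has_RS_integral \<mu> \<phi> a b I" and eq: "\<And>t. t \<in> {a..b} \<Longrightarrow> \<phi> t = \<psi> t"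
  shows "has_RS_integral \<mu> \<psi> a b I"
proof -
  have "RS_sum \<mu> \<psi> xs ts = RS_sum \<mu> \<phi> xs ts" if "fine_tagged a b \<delta> xs ts" for \<delta> xs ts
    unfolding RS_sum_def using fine_tagged_tags[OF that] eq by (intro sum.cong refl) auto
  with I show ?thesis
    unfolding has_RS_integral_iff by metis
qed

text \<open>Without fine partitions every value would be an integral vacuously;
  \<open>ex_fine_tagged\<close> excludes this. Uniqueness is what gives meaning to
  \<open>THE\<close> in \<open>delay_op\<close>.\<close>

lemma has_RS_integral_unique:
  assumes ab: "a \<le> b" and I: "has_RS_integral \<mu> \<phi> a b I" and J: "has_RS_integral \<mu> \<phi> a b J"
  shows "I = J"
proof (rule ccontr)
  assume "I \<noteq> J"
  then have e: "0 < norm (I - J) / 2" by simp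
  obtain \<delta> where \<delta>: "0 < \<delta>" "\<And>xs ts. fine_tagged a b \<delta> xs ts \<Longrightarrow> norm (RS_sum \<mu> \<phi> xs ts - I) < norm (I - J) / 2"
    using I e unfolding has_RS_integral_iff by meson
  obtain \<delta>' where \<delta>': "0 < \<delta>'" "\<And>xs ts. fine_tagged a b \<delta>' xs ts \<Longrightarrow> norm (RS_sum \<mu> \<phi> xs ts - J) < norm (I - J) / 2"
    using J e unfolding has_RS_integral_iff by meson
  obtain xs ts where q: "fine_tagged a b (min \<delta> \<delta>') xs ts"
    using ex_fine_tagged[OF ab, of "min \<delta> \<delta>'"] \<delta>(1) \<delta>'(1) by auto
  have "norm (RS_sum \<mu> \<phi> xs ts - I) < norm (I - J) / 2" "norm (RS_sum \<mu> \<phi> xs ts - J) < norm (I - J) / 2"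
    using \<delta>(2) \<delta>'(2) fine_tagged_mono[OF q] by auto
  moreover have "norm (I - J) \<le> norm (RS_sum \<mu> \<phi> xs ts - J) + norm (RS_sum \<mu> \<phi> xs ts - I)"
    using norm_triangle_ineq4[of "RS_sum \<mu> \<phi> xs ts - J" "RS_sum \<mu> \<phi> xs ts - I"] by simp
  ultimately show False by linarith
qed

section \<open>The delay operator on continuous functions\<close>

lemma delay_op_eq:
  assumes "0 \<le> r" "has_RS_integral \<mu> \<phi> (- r) 0 I"
  shows "delay_op \<mu> r \<phi> = I"
  unfolding delay_op_def using assms has_RS_integral_unique[of "- r" 0 \<mu> \<phi>]
  by (intro the_equality) auto

lemma delay_op_has_RS_integral:
  fixes \<mu> :: "real \<Rightarrow> 'a::banach \<Rightarrow>\<^sub>L 'a"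
  assumes "0 \<le> r" "bounded_variation_on \<mu> (- r) 0" "continuous_on {- r..0} \<phi>"
  shows "has_RS_integral \<mu> \<phi> (- r) 0 (delay_op \<mu> r \<phi>)"
  using has_RS_integral_exists[of "- r" 0 \<mu> \<phi>] delay_op_eq assms by fastforce

text \<open>The decomposition is required on the interval only, since tags never leave it.\<close>

lemma delay_op_add:
  fixes \<mu> :: "real \<Rightarrow> 'a::banach \<Rightarrow>\<^sub>L 'a"
  assumes r: "0 \<le> r" and bv: "bounded_variation_on \<mu> (- r) 0"
    and \<phi>: "continuous_on {- r..0} \<phi>" and \<psi>: "continuous_on {- r..0} \<psi>"
    and eq: "\<And>t. t \<in> {- r..0} \<Longrightarrow> \<eta> t = \<phi> t + \<psi> t"
  shows "delay_op \<mu> r \<eta> = delay_op \<mu> r \<phi> + delay_op \<mu> r \<psi>"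
proof (rule delay_op_eq[OF r])
  have "has_RS_integral \<mu> (\<lambda>t. \<phi> t + \<psi> t) (- r) 0 (delay_op \<mu> r \<phi> + delay_op \<mu> r \<psi>)"
    by (intro has_RS_integral_add delay_op_has_RS_integral r bv \<phi> \<psi>)
  then show "has_RS_integral \<mu> \<eta> (- r) 0 (delay_op \<mu> r \<phi> + delay_op \<mu> r \<psi>)"
    by (rule has_RS_integral_cong) (simp add: eq)
qed

text \<open>The bound on Riemann-Stieltjes sums passes to the limit. A single \<open>V\<close>,
  taken from the bounded variation of \<open>\<mu>\<close>, serves all \<open>\<phi>\<close> and
  \<open>B\<close>.\<close>

lemma delay_op_bounded:
  fixes \<mu> :: "real \<Rightarrow> 'a::banach \<Rightarrow>\<^sub>L 'a"
  assumes r: "0 \<le> r" and bv: "bounded_variation_on \<mu> (- r) 0"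
  obtains V where "0 \<le> V"
    "\<And>\<phi> B. continuous_on {- r..0} \<phi> \<Longrightarrow> (\<And>t. t \<in> {- r..0} \<Longrightarrow> norm (\<phi> t) \<le> B) \<Longrightarrow>
       norm (delay_op \<mu> r \<phi>) \<le> V * B"
proof -
  obtain V where V: "0 \<le> V" "\<And>xs. sorted xs \<Longrightarrow> set xs \<subseteq> {- r..0} \<Longrightarrow> partition_var \<mu> xs \<le> V"
    using bounded_variation_onE[OF bv] by blast
  have "norm (delay_op \<mu> r \<phi>) \<le> V * B"
    if "continuous_on {- r..0} \<phi>" and B: "\<And>t. t \<in> {- r..0} \<Longrightarrow> norm (\<phi> t) \<le> B" for \<phi> B
  proof (rule has_RS_integral_norm_le[OF _ delay_op_has_RS_integral[OF r bv that(1)]])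
    have "0 \<le> B"
      using B[of 0] r by (auto intro: order_trans[OF norm_ge_zero])
    then show "norm (RS_sum \<mu> \<phi> xs ts) \<le> V * B" if "fine_tagged (- r) 0 \<delta> xs ts" for \<delta> xs ts
      by (intro norm_RS_sum_le[OF V(2) that] B)
  qed (use r in simp)
  with V(1) show ?thesis by (rule that)
qed

section \<open>Variation of constants\<close>

text \<open>A mean value inequality with a majorant: instead of integrating a bound on the
  derivative, an explicit antiderivative \<open>\<phi>\<close> of that bound is supplied. One-sided
  derivatives at the end points give continuity there.\<close>

lemma norm_diff_le_if_derivative_le:
  fixes f :: "real \<Rightarrow> 'b::real_normed_vector" and \<phi> :: "real \<Rightarrow> real"
  assumes "a \<le> b"
    and f: "\<And>x. x \<in> {a..b} \<Longrightarrow> (f has_vector_derivative f' x) (at x within {a..b})"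
    and \<phi>: "\<And>x. x \<in> {a..b} \<Longrightarrow> (\<phi> has_vector_derivative \<phi>' x) (at x within {a..b})"
    and le: "\<And>x. x \<in> {a..b} \<Longrightarrow> norm (f' x) \<le> \<phi>' x"
  shows "norm (f b - f a) \<le> \<phi> b - \<phi> a"
proof (cases "a = b")
  case False
  then have "a < b" using assms(1) by simp
  then show ?thesis
  proof (rule differentiable_bound_general[where f' = f' and \<phi>' = \<phi>'])
    show "continuous_on {a..b} f"
      using f by (rule continuous_on_vector_derivative)
    show "continuous_on {a..b} \<phi>"
      using \<phi> by (rule continuous_on_vector_derivative)
    fix x assume x: "a < x" "x < b"
    show "(f has_vector_derivative f' x) (at x)"
      using f[of x] x by (simp add: at_within_Icc_at)
    show "(\<phi> has_vector_derivative \<phi>' x) (at x)"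
      using \<phi>[of x] x by (simp add: at_within_Icc_at)
    show "norm (f' x) \<le> \<phi>' x"
      using le[of x] x by simp
  qed
qed simp

lemma continuous_on_atLeastI:
  fixes f :: "real \<Rightarrow> 'b::topological_space"
  assumes "\<And>b. continuous_on {a..b} f"
  shows "continuous_on {a..} f"
  unfolding continuous_on_eq_continuous_within
proof
  fix x assume "x \<in> {a..}"
  then have "continuous (at x within {a..x + 1}) f"
    using assms[of "x + 1"] by (simp add: continuous_on_eq_continuous_within)
  moreover have "at x within {a..x + 1} = at x within {a..}"
    by (rule at_within_nhd[of _ "{x - 1<..<x + 1}"]) auto
  ultimately show "continuous (at x within {a..}) f" by simp
qed

lemma continuous_on_indefinite_integral:
  fixes h g :: "real \<Rightarrow> 'b::banach"
  assumes hg: "\<And>t. t \<in> {c..d} \<Longrightarrow> (g has_integral (h t - h c)) {c..t}"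
  shows "continuous_on {c..d} h"
proof (cases "c \<le> d")
  case True
  then have "g integrable_on {c..d}"
    using hg[of d] by auto
  then have "continuous_on {c..d} (\<lambda>t. h c + integral {c..t} g)"
    by (intro continuous_intros indefinite_integral_continuous_1)
  then show ?thesis
    by (rule continuous_on_cong[THEN iffD1, rotated 2]) (use integral_unique[OF hg] in auto)
qed simp

lemma W1p_continuous_halfline:
  fixes h :: "real \<Rightarrow> 'b::banach"
  assumes "W1p p a {a..} h g"
  shows "continuous_on {a..} h"
  by (rule continuous_on_atLeastI, rule continuous_on_indefinite_integral)
    (use assms in \<open>auto simp: W1p_def\<close>)

lemma W1p_continuous_interval:
  fixes h :: "real \<Rightarrow> 'b::banach"
  assumes "W1p p a {a..b} h g"
  shows "continuous_on {a..b} h"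
  by (rule continuous_on_indefinite_integral) (use assms in \<open>auto simp: W1p_def\<close>)

lemma W1p_add:
  assumes "0 \<le> p" "S \<in> sets lebesgue" "W1p p a S h g" "W1p p a S h' g'"
  shows "W1p p a S (\<lambda>t. h t + h' t) (\<lambda>t. g t + g' t)"
  unfolding W1p_def
proof (intro conjI ballI)
  fix t assume "t \<in> S"
  then have "((\<lambda>t. g t + g' t) has_integral ((h t - h a) + (h' t - h' a))) {a..t}"
    using assms by (intro has_integral_add) (auto simp: W1p_def)
  then show "((\<lambda>t. g t + g' t) has_integral (h t + h' t - (h a + h' a))) {a..t}"
    by (simp add: algebra_simps)
qed (use assms in \<open>auto simp: W1p_def intro: Lp_add\<close>)

lemma has_vector_derivative_exp_of_real:
  fixes lam :: complex
  shows "((\<lambda>s. exp (lam * complex_of_real s)) has_vector_derivative lam * exp (lam * complex_of_real t)) (at t within S)"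
proof -
  have "((\<lambda>z. exp (lam * z)) has_field_derivative lam * exp (lam * complex_of_real t)) (at (complex_of_real t))"
    by (auto intro!: derivative_eq_intros)
  then show ?thesis
    by (rule has_vector_derivative_real_field)
qed

section \<open>Complex scalar multiplication and the weighted primitive\<close>

locale complex_banach =
  fixes sm :: "complex \<Rightarrow> 'a::banach \<Rightarrow> 'a"
  assumes smul: "complex_banach_smul sm"
begin

lemma sm_sm: "sm c (sm d x) = sm (c * d) x"
  and sm_of_real: "sm (complex_of_real s) x = s *\<^sub>R x"
  and norm_sm: "norm (sm c x) = cmod c * norm x"
  using smul by (auto simp: complex_banach_smul_def)

lemma sm_one [simp]: "sm 1 x = x"
  using sm_of_real[of 1 x] by simp

text \<open>Real scalars act as complex ones, which yields real homogeneity in both arguments. The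
  sublocale that follows provides continuity, the product rule and the algebra of
  \<open>sm\<close>.\<close>

lemma bounded_bilinear_sm: "bounded_bilinear sm"
proof
  show "sm (c + d) x = sm c x + sm d x" "sm c (x + y) = sm c x + sm c y" for c d x y
    using smul by (auto simp: complex_banach_smul_def)
  show "sm (s *\<^sub>R c) x = s *\<^sub>R sm c x" "sm c (s *\<^sub>R x) = s *\<^sub>R sm c x" for s c x
    by (simp_all add: sm_of_real[symmetric] sm_sm scaleR_conv_of_real mult.commute)
  show "\<exists>K. \<forall>c x. norm (sm c x) \<le> norm c * norm x * K"
    by (intro exI[of _ 1]) (simp add: norm_sm)
qed

sublocale sm: bounded_bilinear sm
  by (rule bounded_bilinear_sm)

lemma Lp_sm:
  assumes "0 \<le> p" "S \<in> sets lebesgue" "Lp p S f"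
  shows "Lp p S (\<lambda>t. sm c (f t))"
  by (rule Lp_compose[OF assms, of _ "cmod c"])
    (auto simp: norm_sm intro!: sm.continuous_on continuous_intros)

lemma Lp_sm_const:
  assumes "0 \<le> p" "S \<in> sets lebesgue" "Lp p S a"
  shows "Lp p S (\<lambda>t. sm (a t) w)"
  by (rule Lp_compose[OF assms, of "\<lambda>c. sm c w" "norm w"])
    (auto simp: norm_sm intro!: sm.continuous_on continuous_intros)

text \<open>Since \<open>f\<close> is merely integrable, \<open>exp (- lam s) f s\<close> is avoided: adding the primitive \<open>F\<close> of
  \<open>f\<close> to \<open>h\<close> gives a continuously differentiable function, whatever the regularity of \<open>h'\<close>.\<close>

lemma variation_of_constants:
  fixes h g q :: "real \<Rightarrow> 'a" and lam :: complex
  assumes hg: "\<And>t. t \<in> {c..d} \<Longrightarrow> (g has_integral (h t - h c)) {c..t}"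
    and q: "continuous_on {c..d} q"
  defines "f \<equiv> \<lambda>t. sm lam (h t) - g t - q t"
  defines "F \<equiv> \<lambda>t. integral {c..t} f"
  shows "t \<in> {c..d} \<Longrightarrow> f integrable_on {c..t}" (is "_ \<Longrightarrow> ?int")
    and "t \<in> {c..d} \<Longrightarrow>
      ((\<lambda>s. sm (exp (- lam * complex_of_real s)) (h s + F s)) has_vector_derivative
       - sm (exp (- lam * complex_of_real t)) (sm lam (F t) + q t)) (at t within {c..d})"
      (is "_ \<Longrightarrow> ?deriv")
proof -
  \<comment> \<open>\<open>j\<close> equals \<open>f + g\<close> and is continuous, although neither
    summand need be; \<open>h + F\<close> is \<open>h c\<close> plus the primitive of
    \<open>j\<close>.\<close>
  define j where "j t = sm lam (h t) - q t" for t
  have j: "continuous_on {c..d} j"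
    unfolding j_def
    by (intro continuous_intros sm.continuous_on continuous_on_indefinite_integral[OF hg] q)
  have ji: "j integrable_on {c..t}" if "t \<in> {c..d}" for t
    using that by (intro integrable_continuous_real continuous_on_subset[OF j]) auto
  have f_eq: "f = (\<lambda>t. j t - g t)"
    by (auto simp: f_def j_def algebra_simps)
  have fi: "f integrable_on {c..t}" if "t \<in> {c..d}" for t
    unfolding f_eq using ji[OF that] hg[OF that] by (intro integrable_diff) auto
  then show "t \<in> {c..d} \<Longrightarrow> ?int" .
  have F_eq: "h t + F t = h c + integral {c..t} j" if "t \<in> {c..d}" for t
  proof -
    have "F t = integral {c..t} j - integral {c..t} g"
      unfolding F_def f_eq using ji[OF that] hg[OF that] by (intro integral_diff) auto
    then show ?thesis
      using integral_unique[OF hg[OF that]] by simp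
  qed
  assume t: "t \<in> {c..d}"
  have "((\<lambda>s. h c + integral {c..s} j) has_vector_derivative j t) (at t within {c..d})"
    using has_vector_derivative_add[OF has_vector_derivative_const integral_has_vector_derivative[OF j t]]
    by simp
  from sm.has_vector_derivative[OF has_vector_derivative_exp_of_real[of "- lam"] this]
  have "((\<lambda>s. sm (exp (- lam * complex_of_real s)) (h c + integral {c..s} j)) has_vector_derivative
     sm (exp (- lam * complex_of_real t)) (j t) +
     sm (- lam * exp (- lam * complex_of_real t)) (h c + integral {c..t} j)) (at t within {c..d})" .
  \<comment> \<open>The term with \<open>h\<close> coming from \<open>j\<close> cancels against the
    derivative of the exponential, leaving only \<open>F\<close> and \<open>q\<close>.\<close>
  also have "sm (exp (- lam * complex_of_real t)) (j t) +
     sm (- lam * exp (- lam * complex_of_real t)) (h c + integral {c..t} j) =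
     - sm (exp (- lam * complex_of_real t)) (sm lam (F t) + q t)"
    unfolding F_eq[OF t, symmetric] j_def
    by (simp add: sm.add_right sm.diff_right sm.minus_left sm_sm mult.commute)
  finally have "((\<lambda>s. sm (exp (- lam * complex_of_real s)) (h c + integral {c..s} j)) has_vector_derivative
     - sm (exp (- lam * complex_of_real t)) (sm lam (F t) + q t)) (at t within {c..d})" .
  then show ?deriv
    by (rule has_vector_derivative_transform[rotated 2]) (use t F_eq in auto)
qed

end

section \<open>The Laplace transform and the value at zero\<close>

text \<open>\<open>laplace\<close> is a Lebesgue integral over the half line, while variation of
  constants produces integrals over [0, T]. Domination by exp(-Re lam t) + |a t|^p makes the
  integrand absolutely integrable, so the truncations converge.\<close>

lemma laplace_tendsto:
  fixes a :: "real \<Rightarrow> complex"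
  assumes p: "1 \<le> p" and lam: "0 < Re lam" and a: "continuous_on {0..} a" "Lp p {0..} a"
  shows "((\<lambda>T. integral {0..T} (\<lambda>t. exp (- lam * complex_of_real t) * a t)) \<longlongrightarrow> laplace a lam) at_top"
proof -
  let ?c = "Re lam"
  let ?u = "\<lambda>t. exp (- lam * complex_of_real t) * a t"
  have meas: "(\<lambda>t. indicator {0..} t *\<^sub>R ?u t) \<in> borel_measurable lborel"
  proof -
    have "(\<lambda>t. indicator {0..} t *\<^sub>R ?u t) \<in> borel_measurable borel"
      by (intro borel_measurable_continuous_on_indicator continuous_intros a) auto
    then show ?thesis by simp
  qed
  have le: "ennreal (norm (indicator {0..} t *\<^sub>R ?u t)) \<le>
      ennreal (exp (- ?c * t)) * indicator {0..} t + ennreal (norm (a t) powr p) * indicator {0..} t" for t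
  proof (cases "0 \<le> t")
    case True
    have e: "exp (- ?c * t) \<le> 1"
      using True lam by simp
    have "cmod (?u t) = exp (- ?c * t) * cmod (a t)"
      by (simp add: norm_mult)
    \<comment> \<open>The inequality \<open>le_mult_one_plus_powr\<close> with
      \<open>M = 1\<close>.\<close>
    also have "\<dots> \<le> exp (- ?c * t) * (1 + norm (a t) powr p)"
      using le_mult_one_plus_powr[OF p zero_less_one norm_ge_zero[of "a t"]]
      by (intro mult_left_mono) auto
    also have "\<dots> \<le> exp (- ?c * t) + norm (a t) powr p"
      using e mult_right_mono[OF e, of "norm (a t) powr p"] by (simp add: distrib_left)
    finally have "ennreal (cmod (?u t)) \<le> ennreal (exp (- ?c * t) + norm (a t) powr p)"
      by (rule ennreal_leI)
    then show ?thesis using True by simp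
  qed simp
  have "(\<integral>\<^sup>+ t. ennreal (norm (indicator {0..} t *\<^sub>R ?u t)) \<partial>lborel) \<le>
      (\<integral>\<^sup>+ t. ennreal (exp (- ?c * t)) * indicator {0..} t + ennreal (norm (a t) powr p) * indicator {0..} t \<partial>lebesgue)"
    unfolding nn_integral_completion by (intro nn_integral_mono le)
  also have "\<dots> = (\<integral>\<^sup>+ t. ennreal (exp (- ?c * t)) * indicator {0..} t \<partial>lebesgue) +
      (\<integral>\<^sup>+ t\<in>{0..}. ennreal (norm (a t) powr p) \<partial>lebesgue)"
  proof (rule nn_integral_add)
    show "(\<lambda>t. ennreal (exp (- ?c * t)) * indicator {0..} t) \<in> borel_measurable lebesgue"
      by (rule measurable_completion) measurable
    show "(\<lambda>t. ennreal (norm (a t) powr p) * indicator {0..} t) \<in> borel_measurable lebesgue"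
      using a(2) by (intro strongly_measurable_on_norm_powr) (auto simp: Lp_def)
  qed
  also have "(\<integral>\<^sup>+ t. ennreal (exp (- ?c * t)) * indicator {0..} t \<partial>lebesgue) =
      ennreal (0 - (- exp (- ?c * 0) / ?c))"
    unfolding nn_integral_completion
  proof (rule nn_integral_FTC_atLeast)
    show "((\<lambda>t. - exp (- ?c * t) / ?c) has_real_derivative exp (- ?c * x)) (at x)" for x
      using lam by (auto intro!: derivative_eq_intros simp: field_simps)
    have "((\<lambda>t. - exp (- ?c * t) / ?c) \<longlongrightarrow> - 0 / ?c) at_top"
    proof (intro tendsto_intros)
      have "filterlim (\<lambda>t. - (?c * t)) at_bot at_top"
        using lam by (simp add: filterlim_uminus_at_bot filterlim_tendsto_pos_mult_at_top[OF tendsto_const] filterlim_ident)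
      then show "((\<lambda>t. exp (- ?c * t)) \<longlongrightarrow> 0) at_top"
        by (intro filterlim_compose[OF exp_at_bot]) simp
    qed (use lam in auto)
    then show "((\<lambda>t. - exp (- ?c * t) / ?c) \<longlongrightarrow> 0) at_top" by simp
  qed auto
  also have "\<dots> + (\<integral>\<^sup>+ t\<in>{0..}. ennreal (norm (a t) powr p) \<partial>lebesgue) < \<infinity>"
    using a(2) by (simp add: Lp_def)
  finally have int: "integrable lborel (\<lambda>t. indicator {0..} t *\<^sub>R ?u t)"
    using meas by (intro integrableI_bounded) auto
  have eq: "integral {0..T} ?u = (\<integral> t. indicator {..T} t *\<^sub>R (indicator {0..} t *\<^sub>R ?u t) \<partial>lborel)" for T
  proof -
    have "set_integrable lborel {0..T} ?u"
      by (rule set_integrable_subset[of _ "{0..}"]) (use int in \<open>auto simp: set_integrable_def\<close>)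
    then have "integral {0..T} ?u = (LINT t:{0..T}|lborel. ?u t)"
      by (simp add: set_borel_integral_eq_integral)
    also have "\<dots> = (\<integral> t. indicator {..T} t *\<^sub>R (indicator {0..} t *\<^sub>R ?u t) \<partial>lborel)"
      unfolding set_lebesgue_integral_def
      by (intro Bochner_Integration.integral_cong) (auto simp: indicator_def)
    finally show ?thesis .
  qed
  have "((\<lambda>T. \<integral> t. indicator {..T} t *\<^sub>R (indicator {0..} t *\<^sub>R ?u t) \<partial>lborel) \<longlongrightarrow>
      (\<integral> t. indicator {0..} t *\<^sub>R ?u t \<partial>lborel)) at_top"
    using int by (intro tendsto_integral_at_top) auto
  then show ?thesis
    unfolding eq laplace_def set_lebesgue_integral_def .
qed

text \<open>Otherwise the integrand would be at least 1 on intervals of any length. Boundedness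
  along a sequence of times is all the decay of \<open>h\<close> that is extracted; the factor
  exp(-Re lam T) does the rest.\<close>

lemma Lp_halfline_small_values:
  fixes h :: "real \<Rightarrow> 'b::real_normed_vector"
  assumes p: "0 \<le> p" and h: "Lp p {0..} h"
  shows "\<exists>T\<ge>t0. norm (h T) \<le> 1"
proof (rule ccontr)
  assume "\<not> ?thesis"
  then have *: "1 \<le> norm (h T)" if "t0 \<le> T" for T
    using that by force
  \<comment> \<open>\<open>t0\<close> may be negative, while the integral starts at 0.\<close>
  let ?m = "max t0 0"
  have "emeasure lborel {?m<..<?m + real n} \<le> (\<integral>\<^sup>+ t\<in>{0..}. ennreal (norm (h t) powr p) \<partial>lebesgue)" for n
  proof -
    have "emeasure lborel {?m<..<?m + real n} = (\<integral>\<^sup>+ t. indicator {?m<..<?m + real n} t \<partial>lebesgue)"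
      unfolding nn_integral_completion by simp
    also have "\<dots> \<le> (\<integral>\<^sup>+ t\<in>{0..}. ennreal (norm (h t) powr p) \<partial>lebesgue)"
      using * p by (intro nn_integral_mono) (auto simp: indicator_def ge_one_powr_ge_zero)
    finally show ?thesis .
  qed
  then have "ennreal (real n) \<le> (\<integral>\<^sup>+ t\<in>{0..}. ennreal (norm (h t) powr p) \<partial>lebesgue)" for n
    by simp
  moreover obtain I where "0 \<le> I" "(\<integral>\<^sup>+ t\<in>{0..}. ennreal (norm (h t) powr p) \<partial>lebesgue) = ennreal I"
    using h unfolding Lp_def by (metis less_top_ennreal infinity_ennreal_def)
  ultimately have "real n \<le> I" for n
    by (metis ennreal_le_iff)
  then show False
    using reals_Archimedean2[of I] by (meson not_less)
qed

context complex_banach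
begin

text \<open>Adding the truncated transform applied to \<open>w\<close> to exp(-lam s) (h s + F s)
  cancels the forcing term and leaves the derivative -lam exp(-lam s) F s. Since \<open>F s\<close>
  has norm at most (1 + s) N, the total change is controlled by the integral of (1 + s) exp(-c s)
  over the half line, which is (1 + 1/c) / c with c = Re lam. At 0 the function is
  \<open>h 0\<close>; at infinity only the transform remains.\<close>

lemma halfline_value_at_zero:
  assumes p: "1 \<le> p" and lam: "0 < Re lam" and hg: "W1p p 0 {0..} h g"
    and a: "continuous_on {0..} a" "Lp p {0..} a"
  shows "norm (h 0 - sm (laplace a lam) w) \<le>
    cmod lam / Re lam * (1 + 1 / Re lam) * Lp_norm p {0..} (\<lambda>t. sm lam (h t) - g t - sm (a t) w)"
proof -
  define c where "c = Re lam"
  have c: "0 < c" using lam by (simp add: c_def)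
  define f where "f t = sm lam (h t) - g t - sm (a t) w" for t
  define N where "N = Lp_norm p {0..} f"
  define F where "F t = integral {0..t} f" for t
  define \<beta> where "\<beta> T = integral {0..T} (\<lambda>t. exp (- lam * complex_of_real t) * a t)" for T
  define K where "K = cmod lam / c * (1 + 1 / c)"
  have N: "0 \<le> N" by (simp add: N_def)
  have h: "(g has_integral (h t - h 0)) {0..t}" if "t \<in> {0..T}" for t T
    using hg that by (auto simp: W1p_def)
  have q: "continuous_on {0..T} (\<lambda>t. sm (a t) w)" for T
    by (intro sm.continuous_on continuous_intros continuous_on_subset[OF a(1)]) auto
  have f_Lp: "Lp p {0..} f"
    unfolding f_def using hg p a(2) by (intro Lp_diff Lp_sm Lp_sm_const) (auto simp: W1p_def)
  have exp_norm: "cmod (exp (- lam * complex_of_real t)) = exp (- c * t)" for t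
    by (simp add: c_def)
  have F: "norm (F t) \<le> (1 + t) * N" if "0 \<le> t" for t
  proof -
    have "f integrable_on {0..t}"
      unfolding f_def[abs_def]
      by (rule variation_of_constants(1)[where d = t, OF h[of _ t] q]) (use that in auto)
    then show ?thesis
      using norm_integral_le_Lp_norm[OF p f_Lp, of 0 t] that by (simp add: F_def N_def)
  qed
  have bound: "norm (h 0 - sm (\<beta> T) w) \<le> K * N + exp (- c * T) * (norm (h T) + (1 + T) * N)"
    if T: "0 \<le> T" for T
  proof -
    let ?Z = "\<lambda>s. sm (exp (- lam * complex_of_real s)) (h s + F s) + sm (\<beta> s) w"
    \<comment> \<open>An antiderivative of \<open>cmod lam * N * ((1 + u) * exp (- c * u))\<close>;
      it is nonpositive for u \<ge> 0, and its negative at 0 is \<open>K * N\<close>.\<close>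
    let ?G = "\<lambda>u. - cmod lam * N / c * ((1 + u + 1 / c) * exp (- c * u))"
    have "norm (?Z T - ?Z 0) \<le> ?G T - ?G 0"
    proof (rule norm_diff_le_if_derivative_le[OF T])
      fix s assume s: "s \<in> {0..T}"
      have 1: "((\<lambda>s. sm (exp (- lam * complex_of_real s)) (h s + F s)) has_vector_derivative
          - sm (exp (- lam * complex_of_real s)) (sm lam (F s) + sm (a s) w)) (at s within {0..T})"
        using variation_of_constants(2)[OF h[of _ T] q s, where lam = lam]
        by (simp add: F_def[abs_def] f_def[abs_def])
      have "(\<beta> has_vector_derivative exp (- lam * complex_of_real s) * a s) (at s within {0..T})"
        unfolding \<beta>_def[abs_def]
        by (rule integral_has_vector_derivative[OF _ s])
          (intro continuous_intros continuous_on_subset[OF a(1)], auto)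
      from sm.has_vector_derivative[OF this has_vector_derivative_const, of w]
      have 2: "((\<lambda>s. sm (\<beta> s) w) has_vector_derivative sm (exp (- lam * complex_of_real s) * a s) w) (at s within {0..T})"
        by (simp add: sm.zero_right)
      show "(?Z has_vector_derivative - sm (exp (- lam * complex_of_real s)) (sm lam (F s))) (at s within {0..T})"
        using has_vector_derivative_add[OF 1 2] by (simp add: sm.add_right sm_sm)
      have "(?G has_real_derivative cmod lam * N * ((1 + s) * exp (- c * s))) (at s within {0..T})"
        using c by (auto intro!: derivative_eq_intros simp: field_simps)
      then show "(?G has_vector_derivative cmod lam * N * ((1 + s) * exp (- c * s))) (at s within {0..T})"
        by (simp add: has_real_derivative_iff_has_vector_derivative)
      have "norm (- sm (exp (- lam * complex_of_real s)) (sm lam (F s))) = exp (- c * s) * (cmod lam * norm (F s))"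
        by (simp add: norm_sm c_def)
      also have "\<dots> \<le> exp (- c * s) * (cmod lam * ((1 + s) * N))"
        using F[of s] s by (intro mult_left_mono) auto
      finally show "norm (- sm (exp (- lam * complex_of_real s)) (sm lam (F s))) \<le> cmod lam * N * ((1 + s) * exp (- c * s))"
        by (simp add: mult_ac)
    qed
    also have "\<dots> \<le> - ?G 0"
      using c N T by (simp add: add_nonneg_nonneg)
    also have "\<dots> = K * N"
      by (simp add: K_def)
    finally have Z: "norm (?Z T - ?Z 0) \<le> K * N" .
    have Z0: "?Z 0 = h 0"
      by (simp add: F_def \<beta>_def sm.zero_left)
    have "norm (sm (exp (- lam * complex_of_real T)) (h T + F T)) \<le> exp (- c * T) * (norm (h T) + (1 + T) * N)"
      unfolding norm_sm exp_norm using norm_triangle_ineq[of "h T" "F T"] F[OF T]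
      by (intro mult_left_mono) auto
    moreover have "h 0 - sm (\<beta> T) w = sm (exp (- lam * complex_of_real T)) (h T + F T) - (?Z T - ?Z 0)"
      unfolding Z0 by simp
    then have "norm (h 0 - sm (\<beta> T) w) \<le>
        norm (sm (exp (- lam * complex_of_real T)) (h T + F T)) + norm (?Z T - ?Z 0)"
      by (simp only: norm_triangle_ineq4)
    ultimately show ?thesis using Z by linarith
  qed
  \<comment> \<open>Membership in L^p alone gives no limit of \<open>h\<close> at infinity, so
    \<open>T\<close> runs through times at which the norm of \<open>h\<close> is at most 1.\<close>
  have "\<exists>X. \<forall>n::nat. real n \<le> X n \<and> norm (h (X n)) \<le> 1"
    using Lp_halfline_small_values[of p h] hg p by (intro choice) (auto simp: W1p_def)
  then obtain X where X: "\<And>n::nat. real n \<le> X n" "\<And>n. norm (h (X n)) \<le> 1"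
    by blast
  have X_top: "filterlim X at_top sequentially"
    by (rule filterlim_at_top_mono[OF filterlim_real_sequentially]) (use X in auto)
  have lim1: "(\<lambda>n. norm (h 0 - sm (\<beta> (X n)) w)) \<longlonglongrightarrow> norm (h 0 - sm (laplace a lam) w)"
    by (intro tendsto_intros sm.tendsto filterlim_compose[OF laplace_tendsto[OF p lam a, folded \<beta>_def] X_top])
  have lim2: "((\<lambda>T. K * N + exp (- c * T) * (1 + (1 + T) * N)) \<longlongrightarrow> K * N) at_top"
  proof -
    have "filterlim (\<lambda>T. c * T) at_top at_top"
      by (rule filterlim_tendsto_pos_mult_at_top[OF tendsto_const c filterlim_ident])
    then have e: "((\<lambda>T. (c * T) ^ k / exp (c * T)) \<longlongrightarrow> 0) at_top" for k
      by (rule filterlim_compose[OF tendsto_power_div_exp_0])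
    \<comment> \<open>The boundary term is written with the powers 0 and 1 of \<open>c * T\<close>
      over \<open>exp (c * T)\<close>, each quotient tending to 0.\<close>
    have "((\<lambda>T. K * N + ((1 + N) * ((c * T) ^ 0 / exp (c * T)) + N / c * ((c * T) ^ 1 / exp (c * T))))
        \<longlongrightarrow> K * N + ((1 + N) * 0 + N / c * 0)) at_top"
      by (intro tendsto_intros e)
    moreover have "K * N + ((1 + N) * ((c * T) ^ 0 / exp (c * T)) + N / c * ((c * T) ^ 1 / exp (c * T)))
        = K * N + exp (- c * T) * (1 + (1 + T) * N)" for T
      using c by (simp add: exp_minus divide_inverse algebra_simps)
    ultimately show ?thesis by simp
  qed
  have "norm (h 0 - sm (laplace a lam) w) \<le> K * N"
  proof (rule LIMSEQ_le[OF lim1 filterlim_compose[OF lim2 X_top]])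
    have "norm (h 0 - sm (\<beta> (X n)) w) \<le> K * N + exp (- c * X n) * (1 + (1 + X n) * N)" for n
    proof -
      have "0 \<le> X n"
        using X(1)[of n] by (meson of_nat_0_le_iff order_trans)
      from bound[OF this] show ?thesis
        by (rule order_trans) (intro add_left_mono mult_left_mono add_right_mono X, auto)
    qed
    then show "\<exists>N'. \<forall>n\<ge>N'. norm (h 0 - sm (\<beta> (X n)) w) \<le> K * N + exp (- c * X n) * (1 + (1 + X n) * N)"
      by blast
  qed
  then show ?thesis
    by (simp add: K_def N_def f_def[abs_def] c_def)
qed

section \<open>The delay interval\<close>

lemma continuous_on_exp_fun: "continuous_on S (exp_fun sm lam x)"
  unfolding exp_fun_def by (intro sm.continuous_on continuous_intros)

lemma norm_exp_fun: "norm (exp_fun sm lam x \<theta>) = exp (Re lam * \<theta>) * norm x"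
  by (simp add: exp_fun_def norm_sm)

lemma norm_exp_fun_le:
  assumes "0 < Re lam" "\<theta> \<le> 0"
  shows "norm (exp_fun sm lam x \<theta>) \<le> norm x"
proof -
  have "exp (Re lam * \<theta>) \<le> 1"
    using assms by (simp add: mult_nonneg_nonpos)
  then show ?thesis
    unfolding norm_exp_fun by (intro mult_left_le_one_le) auto
qed

text \<open>Variation of constants with \<open>q = 0\<close>, compared between
  \<open>\<theta>\<close> and 0. The factor \<open>1 + r\<close> bounds the primitive
  \<open>F\<close>; the summand with \<open>exp (Re lam * r)\<close> comes from the derivative bound
  over a length of at most \<open>r\<close>, and the summand 2 from the values of \<open>F\<close>
  at 0 and \<open>\<theta>\<close>.\<close>

lemma delay_value_bound:
  assumes p: "1 \<le> p" and r: "0 < r" and lam: "0 < Re lam" and \<phi>: "W1p p (- r) {- r..0} \<phi> \<psi>"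
    and \<theta>: "\<theta> \<in> {- r..0}"
  shows "norm (\<phi> \<theta> - exp_fun sm lam (\<phi> 0) \<theta>) \<le>
    (1 + r) * (cmod lam * r * exp (Re lam * r) + 2) * Lp_norm p {- r..0} (\<lambda>t. sm lam (\<phi> t) - \<psi> t)"
proof -
  define c where "c = Re lam"
  have c: "0 < c" using lam by (simp add: c_def)
  \<comment> \<open>The trailing 0 matches the residual of \<open>variation_of_constants\<close>
    with \<open>q\<close> identically 0.\<close>
  define f where "f t = sm lam (\<phi> t) - \<psi> t - 0" for t
  define N where "N = Lp_norm p {- r..0} f"
  define F where "F t = integral {- r..t} f" for t
  define Y where "Y s = sm (exp (- lam * complex_of_real s)) (\<phi> s + F s)" for s
  have N: "0 \<le> N" by (simp add: N_def)
  have h: "(\<psi> has_integral (\<phi> t - \<phi> (- r))) {- r..t}" if "t \<in> {- r..0}" for t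
    using \<phi> that by (auto simp: W1p_def)
  have f_Lp: "Lp p {- r..0} f"
    unfolding f_def using \<phi> p by (intro Lp_diff Lp_sm Lp_zero) (auto simp: W1p_def)
  have F: "norm (F t) \<le> (1 + r) * N" if t: "t \<in> {- r..0}" for t
  proof -
    have "norm (F t) \<le> (1 + (t - - r)) * N"
      unfolding F_def N_def using t variation_of_constants(1)[OF h continuous_on_const[where c = 0] t, where lam = lam]
      by (intro norm_integral_le_Lp_norm[OF p f_Lp]) (auto simp: f_def[abs_def])
    also have "\<dots> \<le> (1 + r) * N"
      using t N by (intro mult_right_mono) auto
    finally show ?thesis .
  qed
  have "norm (Y 0 - Y \<theta>) \<le> exp (c * r) * (cmod lam * ((1 + r) * N)) * 0 - exp (c * r) * (cmod lam * ((1 + r) * N)) * \<theta>"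
  proof (rule norm_diff_le_if_derivative_le)
    fix s assume s: "s \<in> {\<theta>..0}"
    then have s': "s \<in> {- r..0}" using \<theta> by auto
    have "(Y has_vector_derivative - sm (exp (- lam * complex_of_real s)) (sm lam (F s) + 0)) (at s within {- r..0})"
      using variation_of_constants(2)[OF h continuous_on_const[where c = 0] s', where lam = lam]
      by (simp add: F_def[abs_def] f_def[abs_def] Y_def[abs_def])
    then show "(Y has_vector_derivative - sm (exp (- lam * complex_of_real s)) (sm lam (F s) + 0)) (at s within {\<theta>..0})"
      by (rule has_vector_derivative_within_subset) (use \<theta> in auto)
    show "((\<lambda>s. exp (c * r) * (cmod lam * ((1 + r) * N)) * s) has_vector_derivative
        exp (c * r) * (cmod lam * ((1 + r) * N))) (at s within {\<theta>..0})"
      by (auto intro!: derivative_eq_intros simp: has_real_derivative_iff_has_vector_derivative[symmetric])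
    have "exp (- c * s) \<le> exp (c * r)"
      using s' c by simp (metis minus_le_iff mult_left_mono less_imp_le mult_minus_right)
    then show "norm (- sm (exp (- lam * complex_of_real s)) (sm lam (F s) + 0)) \<le> exp (c * r) * (cmod lam * ((1 + r) * N))"
      using F[OF s'] by (auto simp: norm_sm c_def intro!: mult_mono)
  qed (use \<theta> in auto)
  also have "\<dots> \<le> exp (c * r) * (cmod lam * ((1 + r) * N)) * r"
    using \<theta> N r by (simp only: mult_zero_right diff_0 mult_minus_right[symmetric]) (intro mult_left_mono, auto)
  finally have Y: "norm (Y 0 - Y \<theta>) \<le> exp (c * r) * (cmod lam * ((1 + r) * N)) * r" .
  \<comment> \<open>Multiplication by \<open>?e\<close> undoes the exponential weight in
    \<open>Y \<theta>\<close>; its modulus is at most 1 because \<open>\<theta>\<close> is not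
    positive.\<close>
  let ?e = "exp (lam * complex_of_real \<theta>)"
  have e: "cmod ?e \<le> 1"
    using c \<theta> by (simp add: c_def mult_nonneg_nonpos)
  have sm_le: "norm (sm ?e x) \<le> norm x" for x
    unfolding norm_sm using e by (intro mult_left_le_one_le) auto
  have Y\<theta>: "sm ?e (Y \<theta>) = \<phi> \<theta> + F \<theta>"
    by (simp add: Y_def sm_sm mult_exp_exp)
  have Y0: "sm ?e (Y 0) = exp_fun sm lam (\<phi> 0) \<theta> + sm ?e (F 0)"
    by (simp add: Y_def exp_fun_def sm.add_right)
  have "\<phi> \<theta> - exp_fun sm lam (\<phi> 0) \<theta> = sm ?e (F 0) - F \<theta> - sm ?e (Y 0 - Y \<theta>)"
    unfolding sm.diff_right Y0 Y\<theta> by simp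
  also have "norm \<dots> \<le> norm (sm ?e (F 0)) + norm (F \<theta>) + norm (sm ?e (Y 0 - Y \<theta>))"
    using norm_triangle_ineq4[of "sm ?e (F 0) - F \<theta>" "sm ?e (Y 0 - Y \<theta>)"] norm_triangle_ineq4[of "sm ?e (F 0)" "F \<theta>"]
    by linarith
  also have "\<dots> \<le> (1 + r) * N + (1 + r) * N + exp (c * r) * (cmod lam * ((1 + r) * N)) * r"
    using F[OF \<theta>] F[of 0] r Y by (intro add_mono order_trans[OF sm_le]) auto
  also have "\<dots> = (1 + r) * (cmod lam * r * exp (Re lam * r) + 2) * N"
    by (simp add: c_def algebra_simps)
  finally show ?thesis
    by (simp add: N_def f_def[abs_def])
qed

lemma W1p_exp_fun:
  assumes p: "0 \<le> p"
  shows "W1p p b {b..d} (exp_fun sm lam x) (\<lambda>\<theta>. sm lam (exp_fun sm lam x \<theta>))"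
proof -
  \<comment> \<open>Scalar values are separable, so Borel measurability gives strong measurability;
    the continuous map \<open>\<lambda>c. sm c x\<close> then carries it into the possibly
    nonseparable space.\<close>
  have "(\<lambda>\<theta>. exp (lam * complex_of_real \<theta>)) \<in> borel_measurable lebesgue"
    by (intro measurable_completion borel_measurable_continuous_onI) (auto intro!: continuous_intros)
  from strongly_measurable_on_compose[OF borel_measurable_imp_strongly_measurable_on[OF this], of "\<lambda>c. sm c x"]
  have meas: "strongly_measurable_on {b..d} (exp_fun sm lam x)"
    by (simp add: exp_fun_def[abs_def] sm.continuous_on)
  have "bounded (exp_fun sm lam x ` {b..d})"
    by (intro compact_imp_bounded compact_continuous_image continuous_on_exp_fun) simp
  then obtain B where B: "\<And>\<theta>. \<theta> \<in> {b..d} \<Longrightarrow> norm (exp_fun sm lam x \<theta>) \<le> B"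
    unfolding bounded_iff by blast
  have "(\<integral>\<^sup>+ t\<in>{b..d}. ennreal (norm (exp_fun sm lam x t) powr p) \<partial>lebesgue) \<le>
      (\<integral>\<^sup>+ t. ennreal (B powr p) * indicator {b..d} t \<partial>lebesgue)"
    using B p by (intro nn_integral_mono) (auto simp: indicator_def intro!: ennreal_leI powr_mono2)
  also have "\<dots> < \<infinity>"
    by (subst nn_integral_cmult_indicator)
      (auto simp: ennreal_mult_less_top emeasure_lborel_Icc_eq)
  finally have Lp: "Lp p {b..d} (exp_fun sm lam x)"
    using meas by (simp add: Lp_def)
  have "((\<lambda>\<theta>. sm lam (exp_fun sm lam x \<theta>)) has_integral exp_fun sm lam x t - exp_fun sm lam x b) {b..t}"
    if "b \<le> t" for t
  proof (rule fundamental_theorem_of_calculus[OF that])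
    fix s
    from sm.has_vector_derivative[OF has_vector_derivative_exp_of_real has_vector_derivative_const]
    show "(exp_fun sm lam x has_vector_derivative sm lam (exp_fun sm lam x s)) (at s within {b..t})"
      by (simp add: exp_fun_def[abs_def] sm_sm sm.zero_right)
  qed
  with Lp Lp_sm[OF p _ Lp] show ?thesis
    by (auto simp: W1p_def)
qed

end

section \<open>Solving the resolvent equations\<close>

lemma Lp_shift_to_halfline:
  fixes \<psi> :: "real \<Rightarrow> 'b::real_normed_vector"
  assumes "Lp p {- r..0} \<psi>"
  shows "Lp p {0..} (\<lambda>t. if t \<in> {0..r} then \<psi> (t + - r) else 0)"
proof -
  have "{t. t + - r \<in> {- r..0}} = {0..r}"
    by auto
  then have "Lp p {0..r} (\<lambda>t. \<psi> (t + - r))"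
    using Lp_translate[OF assms, of "- r"] by simp
  then show ?thesis
    by (rule Lp_extend_by_zero) simp
qed

text \<open>The shift by \<open>r\<close> takes [-r, 0] to [0, r] and matches the base points -r and
  0 from which the two integrals in \<open>W1p\<close> start.\<close>

lemma W1p_translate_to_delay:
  fixes h :: "real \<Rightarrow> 'b::real_normed_vector"
  assumes "W1p p 0 {0..} h g"
  shows "W1p p (- r) {- r..0} (\<lambda>t. h (t + r)) (\<lambda>t. g (t + r))"
proof -
  have Lp: "Lp p {- r..0} (\<lambda>t. u (t + r))" if "Lp p {0..} u" for u :: "real \<Rightarrow> 'b"
    by (rule Lp_subset[OF Lp_translate[OF that, of r]]) auto
  have "((\<lambda>t. g (t + r)) has_integral h (t + r) - h (- r + r)) {- r..t}" if "t \<in> {- r..0}" for t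
  proof -
    have "(g has_integral h (t + r) - h 0) {- r + r..t + r}"
      using assms that by (auto simp: W1p_def)
    then have "((g \<circ> (+) r) has_integral h (t + r) - h 0) {- r..t}"
      by (simp only: has_integral_shift_Icc_real)
    then show ?thesis
      by (simp add: comp_def add.commute)
  qed
  then show ?thesis
    using assms Lp by (auto simp: W1p_def)
qed

context complex_banach
begin

text \<open>In \<open>A_zero\<close> the second component of the equation does not involve
  \<open>x\<close>, so surjectivity with any first datum solves lam h - h' = f on the half
  line.\<close>

lemma A_zero_solve:
  assumes "in_resolvent_X0 sm p (A_zero p D A) lam" "Lp p {0..} f"
  obtains h g where "W1p p 0 {0..} h g" "Lp_norm p {0..} (\<lambda>t. sm lam (h t) - g t - f t) = 0"
  using assms unfolding in_resolvent_X0_def A_zero_def by fastforce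

text \<open>Surjectivity of \<open>lam - \<A>\<^sub>0\<close> also solves the equation on the delay interval: shift the right-hand
  side to the half line. This replaces the Bochner integral of a right-hand side in \<open>L\<^sup>p\<close>.\<close>

lemma delay_solve:
  assumes p: "1 \<le> p" and res: "in_resolvent_X0 sm p (A_zero p D A) lam" and \<psi>: "Lp p {- r..0} \<psi>"
  obtains \<phi> w where "W1p p (- r) {- r..0} \<phi> w" "\<phi> 0 = x"
    "Lp_norm p {- r..0} (\<lambda>t. sm lam (\<phi> t) - w t - \<psi> t) = 0"
proof -
  define f where "f t = (if t \<in> {0..r} then \<psi> (t + - r) else 0)" for t
  have f: "Lp p {0..} f"
    unfolding f_def[abs_def] by (rule Lp_shift_to_halfline[OF \<psi>])
  obtain h g where hg: "W1p p 0 {0..} h g" "Lp_norm p {0..} (\<lambda>t. sm lam (h t) - g t - f t) = 0"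
    using A_zero_solve[OF res f] .
  have "Lp p {0..} (\<lambda>t. sm lam (h t) - g t - f t)"
    using hg(1) p f by (intro Lp_diff Lp_sm) (auto simp: W1p_def)
  then have "AE t in lebesgue. t \<in> {0..} \<longrightarrow> sm lam (h t) - g t - f t = 0"
    using hg(2) p by (subst (asm) Lp_norm_eq_0_iff) auto
  from AE_lebesgue_translate[OF this, of r]
  have ae: "AE t in lebesgue. t + r \<in> {0..} \<longrightarrow> sm lam (h (t + r)) - g (t + r) - f (t + r) = 0" .
  \<comment> \<open>The shifted \<open>h\<close> solves the equation but takes the value
    \<open>h r\<close> at 0; this solution of the homogeneous equation corrects the value to
    \<open>x\<close>.\<close>
  let ?e = "exp_fun sm lam (x - h r)"
  show ?thesis
  proof
    show "W1p p (- r) {- r..0} (\<lambda>t. h (t + r) + ?e t) (\<lambda>t. g (t + r) + sm lam (?e t))"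
      using p by (intro W1p_add W1p_translate_to_delay hg W1p_exp_fun) auto
    show "h (0 + r) + ?e 0 = x"
      by (simp add: exp_fun_def)
    show "Lp_norm p {- r..0} (\<lambda>t. sm lam (h (t + r) + ?e t) - (g (t + r) + sm lam (?e t)) - \<psi> t) = 0"
    proof (rule Lp_norm_eq_0I)
      show "AE t in lebesgue. t \<in> {- r..0} \<longrightarrow>
          sm lam (h (t + r) + ?e t) - (g (t + r) + sm lam (?e t)) - \<psi> t = 0"
        using ae by eventually_elim (auto simp: f_def sm.add_right)
    qed
  qed
qed

end

section \<open>Equivalence of the two resolvent conditions\<close>

theorem theorem4p2:
  fixes sm :: "complex \<Rightarrow> 'a::banach \<Rightarrow> 'a"
    and p r :: real
    and D :: "'a set" and A :: "'a \<Rightarrow> 'a"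
    and a :: "real \<Rightarrow> complex"
    and \<mu> :: "real \<Rightarrow> 'a \<Rightarrow>\<^sub>L 'a"
    and lam :: complex
  assumes X: "complex_banach_smul sm"
    and p: "1 < p"
    and r: "0 < r"
    and gen: "is_C0_generator sm D A"
    and a_W: "\<exists>a'. W1p p 0 {0..} a a'"
    and mu_lin: "\<forall>\<theta>\<in>{-r..0}. complex_linear sm (blinfun_apply (\<mu> \<theta>))"
    and mu_bv: "bounded_variation_on \<mu> (- r) 0"
    and mu_cont: "continuous (at 0 within {-r..0}) \<mu>"
    and mu_var: "((\<lambda>\<epsilon>. total_variation \<mu> (- \<epsilon>) 0) \<longlongrightarrow> 0) (at_right 0)"
    and lam_pos: "0 < Re lam"
    and lam_res1: "in_resolvent_X0 sm p (A_delta0 sm p D A a) lam"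
    and lam_res2: "in_resolvent_X0 sm p (A_zero p D A) lam"
  shows "in_resolvent_XX sm p r (frakA_L sm p r D A a \<mu>) lam \<longleftrightarrow>
         in_resolvent_X sm D
           (\<lambda>x. sm (1 + laplace a lam) (A x) + delay_op \<mu> r (exp_fun sm lam x)) lam"
proof -
  interpret complex_banach sm
    by standard (rule X)
  have p1: "1 \<le> p" and p0: "0 \<le> p" "0 < p" and r0: "0 \<le> r"
    using p r by auto
  obtain a' where a': "W1p p 0 {0..} a a'"
    using a_W by blast
  have a_cont: "continuous_on {0..} a"
    by (rule W1p_continuous_halfline[OF a'])
  have a_Lp: "Lp p {0..} a"
    using a' by (simp add: W1p_def)
  have aA_Lp: "Lp p {0..} (\<lambda>t. sm (a t) w)" for w
    using p0 a_Lp by (intro Lp_sm_const) auto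
  define K where "K = cmod lam / Re lam * (1 + 1 / Re lam)"
  define Kd where "Kd = (1 + r) * (cmod lam * r * exp (Re lam * r) + 2)"
  have K: "0 \<le> K" and Kd: "0 \<le> Kd"
    using lam_pos r by (auto simp: K_def Kd_def intro!: mult_nonneg_nonneg add_nonneg_nonneg)
  have half: "norm (h 0 - sm (laplace a lam) w) \<le> K * Lp_norm p {0..} (\<lambda>t. sm lam (h t) - (sm (a t) w + g t))"
    if "W1p p 0 {0..} h g" for h g w
    using halfline_value_at_zero[OF p1 lam_pos that a_cont a_Lp, of w]
    by (simp add: K_def algebra_simps)
  have delay: "norm (\<phi> \<theta> - exp_fun sm lam (\<phi> 0) \<theta>) \<le> Kd * Lp_norm p {- r..0} (\<lambda>t. sm lam (\<phi> t) - \<psi> t)"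
    if "W1p p (- r) {- r..0} \<phi> \<psi>" "\<theta> \<in> {- r..0}" for \<phi> \<psi> \<theta>
    unfolding Kd_def by (rule delay_value_bound[OF p1 r lam_pos that])
  obtain V where V: "0 \<le> V"
    "\<And>\<phi> B. continuous_on {- r..0} \<phi> \<Longrightarrow> (\<And>t. t \<in> {- r..0} \<Longrightarrow> norm (\<phi> t) \<le> B) \<Longrightarrow>
       norm (delay_op \<mu> r \<phi>) \<le> V * B"
    using delay_op_bounded[OF r0 mu_bv] by blast
  define M where "M x = sm (1 + laplace a lam) (A x) + delay_op \<mu> r (exp_fun sm lam x)" for x
  have split: "delay_op \<mu> r \<phi> = delay_op \<mu> r (exp_fun sm lam (\<phi> 0)) +
      delay_op \<mu> r (\<lambda>\<theta>. \<phi> \<theta> - exp_fun sm lam (\<phi> 0) \<theta>)"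
    if "continuous_on {- r..0} \<phi>" for \<phi>
    using that by (intro delay_op_add[OF r0 mu_bv] continuous_intros continuous_on_exp_fun) auto
  \<comment> \<open>A purely algebraic identity for any \<open>h\<close> and any continuous
    \<open>\<phi>\<close> with value \<open>x\<close> at 0: the residual for \<open>M\<close> is the
    first component of the residual for the large operator plus two defects, which
    \<open>half\<close> and \<open>delay\<close> control. Both directions rest on it.\<close>
  have M_eq: "sm lam x - M x = (sm lam x - (A x + h 0 + delay_op \<mu> r \<phi>)) + (h 0 - sm (laplace a lam) (A x)) +
      delay_op \<mu> r (\<lambda>\<theta>. \<phi> \<theta> - exp_fun sm lam x \<theta>)"
    if "continuous_on {- r..0} \<phi>" "\<phi> 0 = x" for x h \<phi>
    using split[OF that(1)] that(2) by (simp add: M_def sm.add_left)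
  have "in_resolvent_XX sm p r (frakA_L sm p r D A a \<mu>) lam \<longleftrightarrow> in_resolvent_X sm D M lam"
  proof
    assume XX: "in_resolvent_XX sm p r (frakA_L sm p r D A a \<mu>) lam"
    show "in_resolvent_X sm D M lam"
      unfolding in_resolvent_X_def
    proof
      show "\<forall>y. \<exists>x\<in>D. sm lam x - M x = y"
      proof
        fix y
        \<comment> \<open>Zero data in the last two components; the subtracted zeros are the
          instantiated data.\<close>
        have "\<exists>((x, h, \<phi>), (v, k, w))\<in>frakA_L sm p r D A a \<mu>. sm lam x - v = y \<and>
            Lp_norm p {0..} (\<lambda>t. sm lam (h t) - k t - 0) = 0 \<and>
            Lp_norm p {-r..0} (\<lambda>t. sm lam (\<phi> t) - w t - 0) = 0"
          using XX Lp_zero unfolding in_resolvent_XX_def by blast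
        then obtain x h g \<phi> \<psi> where x: "x \<in> D" and hg: "W1p p 0 {0..} h g"
          and \<phi>: "W1p p (- r) {- r..0} \<phi> \<psi>" "\<phi> 0 = x"
          and y: "sm lam x - (A x + h 0 + delay_op \<mu> r \<phi>) = y"
          and h0: "Lp_norm p {0..} (\<lambda>t. sm lam (h t) - (sm (a t) (A x) + g t)) = 0"
          and \<phi>0: "Lp_norm p {- r..0} (\<lambda>t. sm lam (\<phi> t) - \<psi> t) = 0"
          unfolding frakA_L_def by auto
        have \<phi>_cont: "continuous_on {- r..0} \<phi>"
          by (rule W1p_continuous_interval[OF \<phi>(1)])
        \<comment> \<open>With residuals of norm 0, both defects in \<open>M_eq\<close>
          vanish.\<close>
        have "h 0 = sm (laplace a lam) (A x)"
          using half[OF hg, of "A x"] h0 by simp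
        moreover have "norm (delay_op \<mu> r (\<lambda>\<theta>. \<phi> \<theta> - exp_fun sm lam x \<theta>)) \<le> V * 0"
          using delay[OF \<phi>(1)] \<phi>0 \<phi>(2)
          by (intro V(2) continuous_intros \<phi>_cont continuous_on_exp_fun) auto
        ultimately have "sm lam x - M x = y"
          unfolding M_eq[OF \<phi>_cont \<phi>(2), of h] y by simp
        then show "\<exists>x\<in>D. sm lam x - M x = y"
          using x by blast
      qed
      obtain C where C: "\<And>x h \<phi> v k w. ((x, h, \<phi>), (v, k, w)) \<in> frakA_L sm p r D A a \<mu> \<Longrightarrow>
        norm x + Lp_norm p {0..} h + Lp_norm p {-r..0} \<phi> \<le>
          C * (norm (sm lam x - v) + Lp_norm p {0..} (\<lambda>t. sm lam (h t) - k t)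
               + Lp_norm p {-r..0} (\<lambda>t. sm lam (\<phi> t) - w t))"
        using XX unfolding in_resolvent_XX_def by fast
      have "norm x \<le> C * norm (sm lam x - M x)" if x: "x \<in> D" for x
      proof -
        \<comment> \<open>Over the given \<open>x\<close> an element of the large domain is built
          whose last two residuals have norm 0, with the exponential as delay part. Its first
          residual is then exactly \<open>sm lam x - M x\<close>, and the lower bound carries
          over.\<close>
        obtain h g where hg: "W1p p 0 {0..} h g"
            "Lp_norm p {0..} (\<lambda>t. sm lam (h t) - g t - sm (a t) (A x)) = 0"
          using A_zero_solve[OF lam_res2 aA_Lp] .
        have h0: "Lp_norm p {0..} (\<lambda>t. sm lam (h t) - (sm (a t) (A x) + g t)) = 0"
          using hg(2) by (simp add: algebra_simps)
        let ?\<phi> = "exp_fun sm lam x"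
        have \<phi>: "?\<phi> 0 = x"
          by (simp add: exp_fun_def)
        have "((x, h, ?\<phi>), (A x + h 0 + delay_op \<mu> r ?\<phi>, \<lambda>t. sm (a t) (A x) + g t, \<lambda>t. sm lam (?\<phi> t)))
            \<in> frakA_L sm p r D A a \<mu>"
          unfolding frakA_L_def using x hg(1) W1p_exp_fun[OF p0(1)] \<phi> by blast
        from C[OF this] have "norm x + Lp_norm p {0..} h + Lp_norm p {-r..0} ?\<phi> \<le>
            C * norm (sm lam x - (A x + h 0 + delay_op \<mu> r ?\<phi>))"
          using h0 by (simp add: Lp_norm_eq_0I)
        moreover have "h 0 = sm (laplace a lam) (A x)"
          using half[OF hg(1), of "A x"] h0 by simp
        then have M: "A x + h 0 + delay_op \<mu> r ?\<phi> = M x"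
          by (simp add: M_def sm.add_left)
        ultimately show ?thesis
          unfolding M using Lp_norm_nonneg[of p "{0..}" h] Lp_norm_nonneg[of p "{-r..0}" ?\<phi>] by linarith
      qed
      then show "\<exists>C. \<forall>x\<in>D. norm x \<le> C * norm (sm lam x - M x)"
        by blast
    qed
  next
    assume M: "in_resolvent_X sm D M lam"
    show "in_resolvent_XX sm p r (frakA_L sm p r D A a \<mu>) lam"
      unfolding in_resolvent_XX_def
    proof (intro conjI allI impI)
      fix y and f \<psi> :: "real \<Rightarrow> 'a"
      assume f: "Lp p {0..} f" and \<psi>: "Lp p {-r..0} \<psi>"
      \<comment> \<open>Particular solutions for \<open>f\<close> and \<open>\<psi>\<close>,
        independent of \<open>x\<close>; the value 0 of the delay part at 0 keeps the coupling
        condition intact.\<close>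
      obtain hf gf where hf: "W1p p 0 {0..} hf gf" "Lp_norm p {0..} (\<lambda>t. sm lam (hf t) - gf t - f t) = 0"
        using A_zero_solve[OF lam_res2 f] .
      obtain \<phi>f wf where \<phi>f: "W1p p (- r) {- r..0} \<phi>f wf" "\<phi>f 0 = 0"
          "Lp_norm p {- r..0} (\<lambda>t. sm lam (\<phi>f t) - wf t - \<psi> t) = 0"
        using delay_solve[OF p1 lam_res2 \<psi>] .
      \<comment> \<open>The right-hand side compensates what the particular solutions contribute to
        the first component. Only after \<open>x\<close> is fixed can \<open>h1\<close>, the
        response to the forcing by \<open>A x\<close>, be chosen.\<close>
      obtain x where x: "x \<in> D" "sm lam x - M x = y + hf 0 + delay_op \<mu> r \<phi>f"
        using M unfolding in_resolvent_X_def by blast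
      obtain h1 g1 where h1: "W1p p 0 {0..} h1 g1"
          "Lp_norm p {0..} (\<lambda>t. sm lam (h1 t) - g1 t - sm (a t) (A x)) = 0"
        using A_zero_solve[OF lam_res2 aA_Lp] .
      have h10: "h1 0 = sm (laplace a lam) (A x)"
        using half[OF h1(1), of "A x"] h1(2) by (simp add: algebra_simps)
      define h where "h t = h1 t + hf t" for t
      define g where "g t = g1 t + gf t" for t
      define \<phi> where "\<phi> t = exp_fun sm lam x t + \<phi>f t" for t
      define w where "w t = sm lam (exp_fun sm lam x t) + wf t" for t
      have hg: "W1p p 0 {0..} h g"
        unfolding h_def[abs_def] g_def[abs_def] by (intro W1p_add h1 hf p0) auto
      have \<phi>w: "W1p p (- r) {- r..0} \<phi> w"
        unfolding \<phi>_def[abs_def] w_def[abs_def] by (intro W1p_add W1p_exp_fun \<phi>f p0) auto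
      have "\<phi> 0 = x"
        by (simp add: \<phi>_def \<phi>f exp_fun_def)
      then have mem: "((x, h, \<phi>), (A x + h 0 + delay_op \<mu> r \<phi>, \<lambda>t. sm (a t) (A x) + g t, w))
          \<in> frakA_L sm p r D A a \<mu>"
        unfolding frakA_L_def using x(1) hg \<phi>w by blast
      have "delay_op \<mu> r \<phi> = delay_op \<mu> r (exp_fun sm lam x) + delay_op \<mu> r \<phi>f"
        by (rule delay_op_add[OF r0 mu_bv continuous_on_exp_fun W1p_continuous_interval[OF \<phi>f(1)]])
          (simp add: \<phi>_def)
      then have eq1: "sm lam x - (A x + h 0 + delay_op \<mu> r \<phi>) = y"
        using x(2) by (simp add: M_def h_def h10 sm.add_left algebra_simps)
      have ae1: "AE t in lebesgue. t \<in> {0..} \<longrightarrow> sm lam (h1 t) - g1 t - sm (a t) (A x) = 0"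
        using h1 p0 by (subst Lp_norm_eq_0_iff[symmetric]) (auto simp: W1p_def intro!: Lp_diff Lp_sm aA_Lp)
      have ae2: "AE t in lebesgue. t \<in> {0..} \<longrightarrow> sm lam (hf t) - gf t - f t = 0"
        using hf p0 f by (subst Lp_norm_eq_0_iff[symmetric]) (auto simp: W1p_def intro!: Lp_diff Lp_sm)
      have eq2: "Lp_norm p {0..} (\<lambda>t. sm lam (h t) - (sm (a t) (A x) + g t) - f t) = 0"
      proof (rule Lp_norm_eq_0I)
        show "AE t in lebesgue. t \<in> {0..} \<longrightarrow> sm lam (h t) - (sm (a t) (A x) + g t) - f t = 0"
          using ae1 ae2 by eventually_elim (auto simp: h_def g_def sm.add_right algebra_simps)
      qed
      have eq3: "Lp_norm p {-r..0} (\<lambda>t. sm lam (\<phi> t) - w t - \<psi> t) = 0"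
        using \<phi>f(3) by (simp add: \<phi>_def w_def sm.add_right)
      show "\<exists>((x, h, \<phi>), (v, k, w))\<in>frakA_L sm p r D A a \<mu>. sm lam x - v = y \<and>
            Lp_norm p {0..} (\<lambda>t. sm lam (h t) - k t - f t) = 0 \<and>
            Lp_norm p {-r..0} (\<lambda>t. sm lam (\<phi> t) - w t - \<psi> t) = 0"
        by (rule bexI[OF _ mem]) (simp add: eq1 eq2 eq3)
    next
      obtain C1 where "\<And>x. x \<in> D \<Longrightarrow> norm x \<le> C1 * norm (sm lam x - M x)"
        using M unfolding in_resolvent_X_def by blast
      \<comment> \<open>The definition does not fix the sign of the constant; the absolute value
        allows monotone multiplication later.\<close>
      then have C1: "norm x \<le> \<bar>C1\<bar> * norm (sm lam x - M x)" if "x \<in> D" for x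
        using that by (meson abs_ge_self mult_right_mono norm_ge_zero order_trans)
      obtain C2 where C2: "\<And>x h v k. ((x, h), (v, k)) \<in> A_delta0 sm p D A a \<Longrightarrow>
          norm x + Lp_norm p {0..} h \<le>
          C2 * (norm (sm lam x - v) + Lp_norm p {0..} (\<lambda>t. sm lam (h t) - k t))"
        using lam_res1 unfolding in_resolvent_X0_def by fast
      \<comment> \<open>Up to the total residual, \<open>E\<close> bounds the norm of
        \<open>x\<close> through \<open>C1\<close> and \<open>M_eq\<close>, and
        \<open>E + Kd\<close> bounds the supremum norm of \<open>\<phi>\<close>. The latter enters
        with factor \<open>V\<close> as the delay term in the estimate of \<open>h\<close>, and with
        factor \<open>R\<close>, which converts supremum to L^p norm on an interval of length
        \<open>r\<close>.\<close>
      define E where "E = \<bar>C1\<bar> * (1 + K + V * Kd)"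
      define R where "R = r powr (1 / p)"
      define C where "C = E + \<bar>C2\<bar> * (1 + V * (E + Kd)) + R * (E + Kd)"
      have bound: "norm x + Lp_norm p {0..} h + Lp_norm p {-r..0} \<phi> \<le>
          C * (norm (sm lam x - (A x + h 0 + delay_op \<mu> r \<phi>)) +
               Lp_norm p {0..} (\<lambda>t. sm lam (h t) - (sm (a t) (A x) + g t)) +
               Lp_norm p {-r..0} (\<lambda>t. sm lam (\<phi> t) - \<psi> t))"
        if x: "x \<in> D" and hg: "W1p p 0 {0..} h g" and \<phi>: "W1p p (- r) {- r..0} \<phi> \<psi>" "\<phi> 0 = x"
        for x h g \<phi> \<psi>
      proof -
        define Y where "Y = norm (sm lam x - (A x + h 0 + delay_op \<mu> r \<phi>))"
        define Nf where "Nf = Lp_norm p {0..} (\<lambda>t. sm lam (h t) - (sm (a t) (A x) + g t))"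
        define N\<psi> where "N\<psi> = Lp_norm p {-r..0} (\<lambda>t. sm lam (\<phi> t) - \<psi> t)"
        define s where "s = Y + Nf + N\<psi>"
        have nn: "0 \<le> Y" "0 \<le> Nf" "0 \<le> N\<psi>"
          by (simp_all add: Y_def Nf_def N\<psi>_def)
        have \<phi>_cont: "continuous_on {- r..0} \<phi>"
          by (rule W1p_continuous_interval[OF \<phi>(1)])
        have dev: "norm (\<phi> \<theta> - exp_fun sm lam x \<theta>) \<le> Kd * N\<psi>" if "\<theta> \<in> {- r..0}" for \<theta>
          using delay[OF \<phi>(1) that] \<phi>(2) by (simp add: N\<psi>_def)
        have \<phi>_le: "norm (\<phi> \<theta>) \<le> norm x + Kd * N\<psi>" if "\<theta> \<in> {- r..0}" for \<theta>
          using dev[OF that] norm_exp_fun_le[OF lam_pos, of \<theta> x] that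
            norm_triangle_sub[of "\<phi> \<theta>" "exp_fun sm lam x \<theta>"] by auto
        have "norm (sm lam x - M x) \<le> Y + K * Nf + V * (Kd * N\<psi>)"
        proof -
          have "norm (delay_op \<mu> r (\<lambda>\<theta>. \<phi> \<theta> - exp_fun sm lam x \<theta>)) \<le> V * (Kd * N\<psi>)"
            by (intro V(2) continuous_intros \<phi>_cont continuous_on_exp_fun dev)
          then show ?thesis
            unfolding M_eq[OF \<phi>_cont \<phi>(2), of h] using half[OF hg, of "A x"]
            by (intro order_trans[OF norm_triangle_ineq] add_mono) (auto simp: Y_def Nf_def)
        qed
        also have "\<dots> \<le> (1 + K + V * Kd) * s"
          using nn K Kd V(1) by (simp add: s_def algebra_simps add_nonneg_nonneg)
        finally have "\<bar>C1\<bar> * norm (sm lam x - M x) \<le> \<bar>C1\<bar> * ((1 + K + V * Kd) * s)"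
          by (intro mult_left_mono) auto
        then have x_le: "norm x \<le> E * s"
          using C1[OF x] by (simp add: E_def mult.assoc)
        have sN: "Y \<le> s" "Nf \<le> s" "N\<psi> \<le> s" "Y + Nf \<le> s"
          using nn by (auto simp: s_def)
        have x\<psi>: "norm x + Kd * N\<psi> \<le> (E + Kd) * s"
          using x_le mult_left_mono[OF sN(3) Kd] by (simp add: distrib_right)
        \<comment> \<open>\<open>A_delta0\<close> has no delay term, so the delay term moves to the
          data. This is not circular: its bound uses only the norm of \<open>x\<close>, already
          estimated, and the residual on the delay interval.\<close>
        have "norm (sm lam x - (A x + h 0)) \<le> Y + V * ((E + Kd) * s)"
        proof -
          have "norm (delay_op \<mu> r \<phi>) \<le> V * (norm x + Kd * N\<psi>)"
            by (intro V(2) \<phi>_cont \<phi>_le)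
          also have "\<dots> \<le> V * ((E + Kd) * s)"
            by (intro mult_left_mono x\<psi> V)
          finally have "norm (delay_op \<mu> r \<phi>) \<le> V * ((E + Kd) * s)" .
          moreover have "sm lam x - (A x + h 0) = (sm lam x - (A x + h 0 + delay_op \<mu> r \<phi>)) + delay_op \<mu> r \<phi>"
            by simp
          then have "norm (sm lam x - (A x + h 0)) \<le> Y + norm (delay_op \<mu> r \<phi>)"
            unfolding Y_def by (metis norm_triangle_ineq)
          ultimately show ?thesis by linarith
        qed
        then have hN: "norm (sm lam x - (A x + h 0)) + Nf \<le> (1 + V * (E + Kd)) * s"
          using sN(4) by (simp add: algebra_simps)
        have "((x, h), (A x + h 0, \<lambda>t. sm (a t) (A x) + g t)) \<in> A_delta0 sm p D A a"
          unfolding A_delta0_def using x hg by blast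
        from C2[OF this] have "norm x + Lp_norm p {0..} h \<le> C2 * (norm (sm lam x - (A x + h 0)) + Nf)"
          by (simp add: Nf_def)
        also have "\<dots> \<le> \<bar>C2\<bar> * ((1 + V * (E + Kd)) * s)"
          using hN nn by (intro mult_mono) auto
        finally have h_le: "norm x + Lp_norm p {0..} h \<le> \<bar>C2\<bar> * ((1 + V * (E + Kd)) * s)" .
        have "Lp_norm p {-r..0} \<phi> \<le> (0 - - r) powr (1 / p) * (norm x + Kd * N\<psi>)"
          using r p0 by (intro Lp_norm_le_sup \<phi>_le) auto
        also have "\<dots> \<le> R * ((E + Kd) * s)"
          unfolding R_def using x\<psi> by (simp add: mult_left_mono)
        finally have "Lp_norm p {-r..0} \<phi> \<le> R * ((E + Kd) * s)" .
        with h_le x_le have "norm x + Lp_norm p {0..} h + Lp_norm p {-r..0} \<phi> \<le> C * s"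
          using order_trans[OF norm_ge_zero x_le] by (simp add: C_def algebra_simps)
        then show ?thesis
          by (simp add: s_def Y_def Nf_def N\<psi>_def)
      qed
      show "\<exists>C. \<forall>((x, h, \<phi>), (v, k, w))\<in>frakA_L sm p r D A a \<mu>.
        norm x + Lp_norm p {0..} h + Lp_norm p {-r..0} \<phi> \<le>
          C * (norm (sm lam x - v) + Lp_norm p {0..} (\<lambda>t. sm lam (h t) - k t)
               + Lp_norm p {-r..0} (\<lambda>t. sm lam (\<phi> t) - w t))"
        by (rule exI[of _ C]) (use bound in \<open>auto simp: frakA_L_def\<close>)
    qed
  qed
  then show ?thesis
    unfolding M_def[abs_def] .
qed

end
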